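(* There is an absolute constant $c>0$ such that the following holds (for $k$ sufficiently large). Any (possibly randomized) algorithm for the clustering problem with a perfect oracle and side information, even one that knows $f_+$, $f_-$ and the number of clusters $k$, and that does not perform at least $c\,\frac{k^2}{\Delta(f_+,f_-)}$ queries (where $\Delta(f_+,f_-)>0$), will, on some input, be unable to return the correct clustering with probability at least $\frac{1}{10}$. In other words, $\Omega\big(\frac{k^2}{\Delta(f_+,f_-)}\big)$ queries are necessary.
   Context: Clustering problem: the vertex set is $V=[n]=\{1,\dots,n\}$, which is partitioned into $k$ unknown nonempty clusters $V_1,\dots,V_k$ (equivalently, a graph $G$ on $V$ that is a disjoint union of $k$ cliques). Perfect oracle: a query is an unordered pair $\{u,v\}$ of vertices, and the oracle answers $+1$ if $u,v$ are in the same cluster and $-1$ otherwise; queries may be chosen adaptively. Side information: the algorithm is given a symmetric matrix $W=(w_{u,v})$ whose entries (for $u\neq v$) are independent random variables with values in $[0,1]$, where $w_{u,v}$ has distribution (density or mass function) $f_+$ if $u,v$ lie in the same cluster and $f_-$ otherwise. For distributions $P,Q$, $D(P\|Q)=\int dP\ln\frac{dP}{dQ}$ is the Kullback–Leibler divergence, and $\Delta(f_+,f_-)=D(f_+\|f_-)+D(f_-\|f_+)$. The query complexity is the (expected) number of queries made.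
   Formalization: "k sufficiently large" is read as: larger than a threshold depending only on an upper bound for Δ(f₊,f₋); with a threshold independent of Δ the claim fails (for k fixed and very large Δ, zero queries suffice). The constant c stays absolute, and "some input" ranges over n too. *)

theory Defs
  imports "HOL-Probability.Probability"
begin

definition clusterings :: "nat \<Rightarrow> nat \<Rightarrow> nat set set set" where
  "clusterings n k = {P. partition_on {1..n} P \<and> card P = k}"

definition vertex_pairs :: "nat \<Rightarrow> nat set set" where
  "vertex_pairs n = {e. e \<subseteq> {1..n} \<and> card e = 2}"

text \<open>The perfect oracle: its answer to the query \<open>{u, v}\<close> is $+1$ if the following
  holds for \<open>e = {u, v}\<close>, and $-1$ otherwise.\<close>

definition same_cluster :: "nat set set \<Rightarrow> nat set \<Rightarrow> bool" where
  "same_cluster P e \<longleftrightarrow> (\<exists>C\<in>P. e \<subseteq> C)"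

text \<open>For a fixed random seed and fixed side information an adaptive algorithm is a decision
  tree. In \<open>Query e t1 t2\<close> the algorithm goes on with \<open>t1\<close> after the answer $+1$ and with
  \<open>t2\<close> after the answer $-1$.\<close>

datatype dtree = Return "nat set set" | Query "nat set" dtree dtree

primrec queries_within :: "nat \<Rightarrow> dtree \<Rightarrow> bool" where
  "queries_within n (Return C) \<longleftrightarrow> True"
| "queries_within n (Query e t1 t2) \<longleftrightarrow>
     e \<in> vertex_pairs n \<and> queries_within n t1 \<and> queries_within n t2"

primrec result :: "nat set set \<Rightarrow> dtree \<Rightarrow> nat set set" where
  "result P (Return C) = C"
| "result P (Query e t1 t2) = (if same_cluster P e then result P t1 else result P t2)"

primrec num_queries :: "nat set set \<Rightarrow> dtree \<Rightarrow> nat" where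
  "num_queries P (Return C) = 0"
| "num_queries P (Query e t1 t2) =
     Suc (if same_cluster P e then num_queries P t1 else num_queries P t2)"

definition distribution_on_unit :: "real measure \<Rightarrow> bool" where
  "distribution_on_unit f \<longleftrightarrow> prob_space f \<and> sets f = sets borel \<and> (AE x in f. x \<in> {0..1})"

text \<open>The symmetric random matrix \<open>W\<close> without its diagonal: the entry \<open>w\<^sub>u\<^sub>,\<^sub>v = w\<^sub>v\<^sub>,\<^sub>u\<close> is the
  coordinate with index \<open>{u, v}\<close>.\<close>

definition side_information ::
    "real measure \<Rightarrow> real measure \<Rightarrow> nat \<Rightarrow> nat set set \<Rightarrow> (nat set \<Rightarrow> real) measure" where
  "side_information f_plus f_minus n P =
     (\<Pi>\<^sub>M e\<in>vertex_pairs n. if same_cluster P e then f_plus else f_minus)"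

text \<open>A randomized algorithm draws a seed \<open>r\<close> from \<open>R\<close>, independently of everything else, and on
  side information \<open>W\<close> for the vertex set \<open>{1..n}\<close> it runs the decision tree \<open>A n r W\<close>. All other
  data (the two distributions and the number of clusters) may be built into \<open>A\<close>.\<close>

definition clustering_algorithm ::
    "real measure \<Rightarrow> (nat \<Rightarrow> real \<Rightarrow> (nat set \<Rightarrow> real) \<Rightarrow> dtree) \<Rightarrow> bool" where
  "clustering_algorithm R A \<longleftrightarrow>
     prob_space R \<and>
     (\<forall>n. (\<lambda>(r, W). A n r W) \<in>
        R \<Otimes>\<^sub>M (\<Pi>\<^sub>M e\<in>vertex_pairs n. borel) \<rightarrow>\<^sub>M count_space UNIV) \<and>
     (\<forall>n r W. queries_within n (A n r W))"

definition expected_queries ::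
    "real measure \<Rightarrow> real measure \<Rightarrow> real measure \<Rightarrow>
     (nat \<Rightarrow> real \<Rightarrow> (nat set \<Rightarrow> real) \<Rightarrow> dtree) \<Rightarrow> nat \<Rightarrow> nat set set \<Rightarrow> ennreal" where
  "expected_queries f_plus f_minus R A n P =
     (\<integral>\<^sup>+ (r, W). of_nat (num_queries P (A n r W))
        \<partial>(R \<Otimes>\<^sub>M side_information f_plus f_minus n P))"

definition failure_prob ::
    "real measure \<Rightarrow> real measure \<Rightarrow> real measure \<Rightarrow>
     (nat \<Rightarrow> real \<Rightarrow> (nat set \<Rightarrow> real) \<Rightarrow> dtree) \<Rightarrow> nat \<Rightarrow> nat set set \<Rightarrow> real" where
  "failure_prob f_plus f_minus R A n P =
     \<P>((r, W) in R \<Otimes>\<^sub>M side_information f_plus f_minus n P. result P (A n r W) \<noteq> P)"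

text \<open>\<open>KL P Q\<close> is $D(P \| Q)$. The library's \<^const>\<open>KL_divergence\<close> takes its arguments in the
  opposite order and is only meaningful when the divergence is finite; the other cases are
  $\infty$ here. (The negative part of $\ln (dP/dQ)$ is always $P$-integrable, and the integral is
  nonnegative, so nothing is lost in \<^typ>\<open>ennreal\<close>.)\<close>

definition KL :: "real measure \<Rightarrow> real measure \<Rightarrow> ennreal" where
  "KL P Q =
     (if absolutely_continuous Q P \<and> integrable P (entropy_density (exp 1) Q P)
      then ennreal (KL_divergence (exp 1) Q P) else \<infinity>)"

definition sym_KL :: "real measure \<Rightarrow> real measure \<Rightarrow> ennreal" where
  "sym_KL f_plus f_minus = KL f_plus f_minus + KL f_minus f_plus"

end

theory Submission
  imports Defs
begin

text \<open>
  Fix a reference clustering with \<open>k + 1\<close> clusters and a family of alternatives, each of which merges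
  two of its clusters. While all answers are those of the reference, one query excludes at most one
  alternative; so if the side information hardly separates the alternatives from the reference, an
  algorithm with few queries outputs the wrong clustering for most of them.

  For \<open>\<Delta> \<le> 1/10\<close> there are \<open>k\<close> seeds and about \<open>k / (10 \<Delta>)\<close> further vertices, placed uniformly at
  random in the \<open>k\<close> clusters. The reference isolates one of these vertices. The clusters have average
  size at most \<open>1 + 1 / (10 \<Delta>)\<close>, so by the Donsker--Varadhan inequality the side information about the vertex
  is negligible and it needs a number of queries of order \<open>k\<close>.

  For \<open>1/10 < \<Delta> \<le> B\<close> all clusters are singletons except for a random matching of \<open>m\<close> pairs, where \<open>m\<close>
  depends only on \<open>B\<close>. As \<open>D(f\<^sub>- \<parallel> f\<^sub>+) \<le> B\<close>, the density of \<open>f\<^sub>+\<close> relative to \<open>f\<^sub>-\<close> is at least some \<open>\<delta>\<close>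
  on a set of \<open>f\<^sub>-\<close>-measure at least \<open>3/4\<close>. Hence \<open>f\<^sub>+\<close> is a mixture in which, with probability at least
  \<open>3\<delta>/4\<close>, the weight of a matched pair is drawn like that of an unmatched pair conditioned on this set.
  With high probability this happens for one of the \<open>m\<close> pairs, and finding that pair among
  the unmatched vertices needs a number of queries of order \<open>k\<^sup>2\<close>.
\<close>

section \<open>Decision trees and elimination of alternatives\<close>

text \<open>Counting only the pairs in \<open>E\<close> allows queries to be charged to vertices, so
  that the cost of locating one vertex can be isolated from the total.\<close>

primrec queries_in :: "nat set set \<Rightarrow> nat set set \<Rightarrow> dtree \<Rightarrow> nat" where
  "queries_in E P (Return C) = 0"
| "queries_in E P (Query e t1 t2) =
     (if e \<in> E then 1 else 0) + (if same_cluster P e then queries_in E P t1 else queries_in E P t2)"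

lemma queries_in_mono: "E \<subseteq> F \<Longrightarrow> queries_in E P t \<le> queries_in F P t"
  by (induction t) auto

lemma queries_in_le_num_queries: "queries_in E P t \<le> num_queries P t"
  by (induction t) auto

lemma finite_vertex_pairs: "finite (vertex_pairs n)"
  by (rule finite_subset[of _ "Pow {1..n}"]) (auto simp: vertex_pairs_def)

text \<open>Double counting: a queried pair contains two vertices, so no query is charged more than
  twice.\<close>

lemma sum_queries_in_vertex_le:
  assumes "finite V" "queries_within n t"
  shows "(\<Sum>v\<in>V. queries_in {e. v \<in> e} P t) \<le> 2 * num_queries P t"
  using assms(2)
proof (induction t)
  case (Query e t1 t2)
  have "(\<Sum>v\<in>V. if v \<in> e then 1 else 0::nat) = card (V \<inter> e)"
    using assms(1) by (simp add: sum.If_cases)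
  also have "\<dots> \<le> card e"
    using Query.prems by (intro card_mono) (auto simp: vertex_pairs_def intro: card_ge_0_finite)
  also have "\<dots> = 2"
    using Query.prems by (simp add: vertex_pairs_def)
  finally have "(\<Sum>v\<in>V. if v \<in> e then 1 else 0::nat) \<le> 2" .
  with Query show ?case
    by (auto simp: sum.distrib)
qed auto

text \<open>Each query that separates the reference clustering from one of the alternatives singles out
  a unique alternative, so \<open>K\<close> such queries eliminate at most \<open>K\<close> of them.\<close>

lemma few_alternatives_probed:
  assumes same: "\<And>x e. x \<in> X \<Longrightarrow> e \<in> vertex_pairs n \<Longrightarrow>
      same_cluster (P x) e \<longleftrightarrow> same_cluster P0 e \<or> e \<in> S x"
    and disj: "disjoint_family_on S X"
    and t: "queries_within n t"
  shows "\<exists>D. finite D \<and> card D \<le> K \<and>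
    (\<forall>x\<in>X - D. K \<le> queries_in (\<Union>x\<in>X. S x) (P x) t \<or> result (P x) t = result P0 t)"
  using t
proof (induction t arbitrary: K)
  case (Return C)
  show ?case by (intro exI[of _ "{}"]) auto
next
  case (Query e t1 t2)
  \<comment> \<open>An alternative follows the branch of the reference unless the query lies in its
    own set \<open>S x\<close>.\<close>
  define t where "t = (if same_cluster P0 e then t1 else t2)"
  have IH: "\<exists>D. finite D \<and> card D \<le> K \<and>
    (\<forall>x\<in>X - D. K \<le> queries_in (\<Union>x\<in>X. S x) (P x) t \<or> result (P x) t = result P0 t)" for K
    using Query by (auto simp: t_def)
  have e: "e \<in> vertex_pairs n" using Query.prems by simp
  \<comment> \<open>Without budget the bound \<open>K \<le> queries_in\<close> is trivial, and a
    query outside all \<open>S x\<close> is answered for everyone as for the reference. Any other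
    query costs one unit of budget and removes the single \<open>y\<close> that owns it; it raises
    the count of every remaining alternative by one.\<close>
  consider "K = 0" | "e \<notin> (\<Union>x\<in>X. S x)" | K' y where "K = Suc K'" "y \<in> X" "e \<in> S y"
    by (cases K) auto
  then show ?case
  proof cases
    case 1
    then show ?thesis by (intro exI[of _ "{}"]) auto
  next
    case 2
    then have "same_cluster (P x) e \<longleftrightarrow> same_cluster P0 e" if "x \<in> X" for x
      using same[OF that e] that by auto
    with IH[of K] 2 show ?thesis
      by (auto simp: t_def)
  next
    case 3
    from IH[of K'] obtain D where D: "finite D" "card D \<le> K'"
      "\<forall>x\<in>X - D. K' \<le> queries_in (\<Union>x\<in>X. S x) (P x) t \<or> result (P x) t = result P0 t"
      by blast
    have "same_cluster (P x) e \<longleftrightarrow> same_cluster P0 e" if "x \<in> X - insert y D" for x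
      using same[of x, OF _ e] that 3 disj by (auto simp: disjoint_family_on_def)
    with D 3 show ?thesis
      by (intro exI[of _ "insert y D"]) (auto simp: t_def card_insert_if)
  qed
qed

text \<open>A correct run with fewer than \<open>K\<close> relevant queries belongs to one of at
  most \<open>K\<close> exceptional alternatives or to the one whose clustering the reference run
  outputs. The latter is unique because \<open>P\<close> is injective, whence
  \<open>K + 1\<close>.\<close>

lemma success_indicator_sum_le:
  assumes same: "\<And>x e. x \<in> X \<Longrightarrow> e \<in> vertex_pairs n \<Longrightarrow>
      same_cluster (P x) e \<longleftrightarrow> same_cluster P0 e \<or> e \<in> S x"
    and disj: "disjoint_family_on S X"
    and ne: "\<And>x. x \<in> X \<Longrightarrow> \<exists>e\<in>S x. e \<in> vertex_pairs n \<and> \<not> same_cluster P0 e"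
    and X: "finite X"
  obtains Y where
    "\<And>t. queries_within n t \<Longrightarrow> (\<Sum>x\<in>X. of_bool (Y x t)) \<le> K + (1::nat)"
    "\<And>x t. queries_within n t \<Longrightarrow> x \<in> X \<Longrightarrow> result (P x) t = P x \<Longrightarrow>
       Y x t \<or> K \<le> queries_in (\<Union>x\<in>X. S x) (P x) t"
proof -
  \<comment> \<open>A pair that \<open>P x\<close> joins but the reference separates must also lie
    in \<open>S y\<close> if \<open>P x = P y\<close>.\<close>
  have inj: "inj_on P X"
  proof (rule inj_onI)
    fix x y assume xy: "x \<in> X" "y \<in> X" "P x = P y"
    from ne[OF xy(1)] obtain e where e: "e \<in> S x" "e \<in> vertex_pairs n" "\<not> same_cluster P0 e"
      by blast
    with same[of x e] same[of y e] xy have "e \<in> S y" by auto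
    with e xy disj show "x = y" by (auto simp: disjoint_family_on_def)
  qed
  \<comment> \<open>Choosing one exceptional set for each tree makes \<open>Y\<close> a predicate on
    trees, hence an event, since trees carry the discrete sigma-algebra.\<close>
  define D where "D t = (SOME D. finite D \<and> card D \<le> K \<and>
    (\<forall>x\<in>X - D. K \<le> queries_in (\<Union>x\<in>X. S x) (P x) t \<or> result (P x) t = result P0 t))" for t
  have D: "finite (D t)" "card (D t) \<le> K"
      "\<And>x. x \<in> X - D t \<Longrightarrow>
        K \<le> queries_in (\<Union>x\<in>X. S x) (P x) t \<or> result (P x) t = result P0 t"
    if "queries_within n t" for t
    using someI_ex[OF few_alternatives_probed[OF same disj that, of K]] by (auto simp: D_def)
  define Y where "Y x t \<longleftrightarrow> x \<in> D t \<or> P x = result P0 t" for x t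
  have "(\<Sum>x\<in>X. of_bool (Y x t)) \<le> K + (1::nat)" if "queries_within n t" for t
  proof -
    have "(\<Sum>x\<in>X. of_bool (Y x t)) = card {x\<in>X. Y x t}"
      using X by (simp add: of_bool_def sum.If_cases Int_def)
    also have "\<dots> \<le> card (D t \<union> {x\<in>X. P x = result P0 t})"
      using D[OF that] X by (intro card_mono) (auto simp: Y_def)
    also have "\<dots> \<le> card (D t) + card {x\<in>X. P x = result P0 t}"
      by (rule card_Un_le)
    also have "card {x\<in>X. P x = result P0 t} \<le> 1"
      using inj X by (intro card_le_Suc0_iff_eq[THEN iffD2, simplified, unfolded One_nat_def[symmetric]])
        (auto simp: inj_on_def)
    finally show ?thesis using D[OF that] by linarith
  qed
  moreover have "Y x t \<or> K \<le> queries_in (\<Union>x\<in>X. S x) (P x) t"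
    if "queries_within n t" "x \<in> X" "result (P x) t = P x" for x t
    using D(3)[OF that(1), of x] that by (auto simp: Y_def)
  ultimately show ?thesis using that by blast
qed

text \<open>The weights \<open>g x\<close> stand for densities of the alternatives and
  \<open>g0\<close> for that of the reference. Success requires \<open>K\<close> relevant queries,
  which Markov's inequality controls, or the event \<open>Y x\<close>. By \<open>dom\<close> this
  event is moved to the reference, where the events of all alternatives together weigh at most
  \<open>K + 1\<close> times the mass of \<open>g0\<close>.\<close>

lemma sum_weight_le_failure:
  fixes A :: "'a \<Rightarrow> dtree" and g :: "'x \<Rightarrow> 'a \<Rightarrow> ennreal"
  assumes same: "\<And>x e. x \<in> X \<Longrightarrow> e \<in> vertex_pairs n \<Longrightarrow>
      same_cluster (P x) e \<longleftrightarrow> same_cluster P0 e \<or> e \<in> S x"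
    and disj: "disjoint_family_on S X"
    and ne: "\<And>x. x \<in> X \<Longrightarrow> \<exists>e\<in>S x. e \<in> vertex_pairs n \<and> \<not> same_cluster P0 e"
    and X: "finite X"
    and A[measurable]: "A \<in> M \<rightarrow>\<^sub>M count_space UNIV"
    and qw: "\<And>\<omega>. queries_within n (A \<omega>)"
    and g[measurable]: "\<And>x. x \<in> X \<Longrightarrow> g x \<in> borel_measurable M"
    and g0[measurable]: "g0 \<in> borel_measurable M"
    and K: "0 < K"
    and dom: "\<And>x Y. x \<in> X \<Longrightarrow> Y \<in> sets M \<Longrightarrow>
       (\<integral>\<^sup>+ \<omega>. g x \<omega> * indicator Y \<omega> \<partial>M) \<le> b x + a * (\<integral>\<^sup>+ \<omega>. g0 \<omega> * indicator Y \<omega> \<partial>M)"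
  shows "(\<Sum>x\<in>X. \<integral>\<^sup>+ \<omega>. g x \<omega> \<partial>M)
    \<le> (\<Sum>x\<in>X. (\<integral>\<^sup>+ \<omega>. g x \<omega> * of_bool (result (P x) (A \<omega>) \<noteq> P x) \<partial>M)
          + (\<integral>\<^sup>+ \<omega>. g x \<omega> * of_nat (queries_in (\<Union>x\<in>X. S x) (P x) (A \<omega>)) \<partial>M) / of_nat K)
      + (\<Sum>x\<in>X. b x) + a * (of_nat (K + 1) * (\<integral>\<^sup>+ \<omega>. g0 \<omega> \<partial>M))"
proof -
  let ?N = "\<lambda>x \<omega>. queries_in (\<Union>x\<in>X. S x) (P x) (A \<omega>)"
  obtain Y where Y: "\<And>t. queries_within n t \<Longrightarrow> (\<Sum>x\<in>X. of_bool (Y x t)) \<le> K + (1::nat)"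
    "\<And>x t. queries_within n t \<Longrightarrow> x \<in> X \<Longrightarrow> result (P x) t = P x \<Longrightarrow>
       Y x t \<or> K \<le> queries_in (\<Union>x\<in>X. S x) (P x) t"
    using success_indicator_sum_le[OF same disj ne X] by metis
  have meas: "(\<lambda>\<omega>. h (A \<omega>)) \<in> borel_measurable M" for h :: "dtree \<Rightarrow> ennreal"
    by (rule measurable_compose[OF A]) simp
  have Yset: "{\<omega>\<in>space M. Y x (A \<omega>)} \<in> sets M" for x
    using measurable_sets[OF A, of "{t. Y x t}"] by (simp add: vimage_def Int_def conj_commute)
  have ptw: "1 \<le> of_bool (result (P x) (A \<omega>) \<noteq> P x) + (of_nat (?N x \<omega>) / of_nat K)
      + (of_bool (Y x (A \<omega>)) :: ennreal)" if x: "x \<in> X" for x \<omega>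
  proof -
    consider "result (P x) (A \<omega>) \<noteq> P x" | "Y x (A \<omega>)" | "K \<le> ?N x \<omega>"
      using Y(2)[OF qw x] by blast
    then show ?thesis
    proof cases
      case 3
      then have "(of_nat K :: ennreal) / of_nat K \<le> of_nat (?N x \<omega>) / of_nat K"
        by (intro divide_right_mono_ennreal) simp
      moreover have "(of_nat K :: ennreal) / of_nat K = 1"
        using K by (intro ennreal_divide_self) (auto simp: of_nat_less_top)
      ultimately have "(1::ennreal) \<le> of_nat (?N x \<omega>) / of_nat K"
        by simp
      then show ?thesis
        by (rule add_increasing2[OF zero_le add_increasing[OF zero_le]])
    qed (auto simp: add_increasing add_increasing2)
  qed
  have each: "(\<integral>\<^sup>+ \<omega>. g x \<omega> \<partial>M) \<le>
      (\<integral>\<^sup>+ \<omega>. g x \<omega> * of_bool (result (P x) (A \<omega>) \<noteq> P x) \<partial>M)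
          + (\<integral>\<^sup>+ \<omega>. g x \<omega> * of_nat (?N x \<omega>) \<partial>M) / of_nat K
      + (b x + a * (\<integral>\<^sup>+ \<omega>. g0 \<omega> * of_bool (Y x (A \<omega>)) \<partial>M))" if x: "x \<in> X" for x
  proof -
    have m: "(\<lambda>\<omega>. g x \<omega> * h (A \<omega>)) \<in> borel_measurable M" for h
      by (intro borel_measurable_times_ennreal g x meas)
    note m' = m[of "\<lambda>t. of_bool (result (P x) t \<noteq> P x)"]
      m[of "\<lambda>t. of_nat (queries_in (\<Union>x\<in>X. S x) (P x) t)"] m[of "\<lambda>t. of_bool (Y x t)"]
    have "(\<integral>\<^sup>+ \<omega>. g x \<omega> \<partial>M) \<le> (\<integral>\<^sup>+ \<omega>. g x \<omega> * of_bool (result (P x) (A \<omega>) \<noteq> P x)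
        + (g x \<omega> * of_nat (?N x \<omega>)) / of_nat K + g x \<omega> * of_bool (Y x (A \<omega>)) \<partial>M)"
    proof (rule nn_integral_mono)
      fix \<omega>
      have "g x \<omega> * 1 \<le> g x \<omega> * (of_bool (result (P x) (A \<omega>) \<noteq> P x) + (of_nat (?N x \<omega>) / of_nat K)
        + of_bool (Y x (A \<omega>)))"
        by (intro mult_left_mono ptw x) simp
      then show "g x \<omega> \<le> g x \<omega> * of_bool (result (P x) (A \<omega>) \<noteq> P x)
        + (g x \<omega> * of_nat (?N x \<omega>)) / of_nat K + g x \<omega> * of_bool (Y x (A \<omega>))"
        by (simp add: distrib_left ennreal_times_divide)
    qed
    also have "\<dots> = (\<integral>\<^sup>+ \<omega>. g x \<omega> * of_bool (result (P x) (A \<omega>) \<noteq> P x) \<partial>M)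
          + (\<integral>\<^sup>+ \<omega>. g x \<omega> * of_nat (?N x \<omega>) \<partial>M) / of_nat K
          + (\<integral>\<^sup>+ \<omega>. g x \<omega> * of_bool (Y x (A \<omega>)) \<partial>M)"
      using m' by (simp add: nn_integral_add nn_integral_divide)
    also have "(\<integral>\<^sup>+ \<omega>. g x \<omega> * of_bool (Y x (A \<omega>)) \<partial>M) =
        (\<integral>\<^sup>+ \<omega>. g x \<omega> * indicator {\<omega>\<in>space M. Y x (A \<omega>)} \<omega> \<partial>M)"
      by (intro nn_integral_cong) (auto simp: indicator_def)
    also have "\<dots> \<le> b x + a * (\<integral>\<^sup>+ \<omega>. g0 \<omega> * indicator {\<omega>\<in>space M. Y x (A \<omega>)} \<omega> \<partial>M)"
      by (rule dom[OF x Yset])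
    also have "(\<integral>\<^sup>+ \<omega>. g0 \<omega> * indicator {\<omega>\<in>space M. Y x (A \<omega>)} \<omega> \<partial>M) =
        (\<integral>\<^sup>+ \<omega>. g0 \<omega> * of_bool (Y x (A \<omega>)) \<partial>M)"
      by (intro nn_integral_cong) (auto simp: indicator_def)
    finally show ?thesis by (simp add: add_left_mono)
  qed
  \<comment> \<open>All events now have the same weight \<open>g0\<close>, so the sum can be taken
    inside the integral, where the pointwise count \<open>K + 1\<close> applies.\<close>
  have "(\<Sum>x\<in>X. \<integral>\<^sup>+ \<omega>. g0 \<omega> * of_bool (Y x (A \<omega>)) \<partial>M) =
      (\<integral>\<^sup>+ \<omega>. (\<Sum>x\<in>X. g0 \<omega> * of_bool (Y x (A \<omega>))) \<partial>M)"
    by (intro nn_integral_sum[symmetric] borel_measurable_times_ennreal g0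
        meas[of "\<lambda>t. of_bool (Y _ t)"])
  also have "\<dots> \<le> (\<integral>\<^sup>+ \<omega>. of_nat (K + 1) * g0 \<omega> \<partial>M)"
  proof (rule nn_integral_mono)
    fix \<omega>
    have "(\<Sum>x\<in>X. g0 \<omega> * of_bool (Y x (A \<omega>))) = g0 \<omega> * of_nat (\<Sum>x\<in>X. of_bool (Y x (A \<omega>)))"
      by (simp add: sum_distrib_left)
    also have "\<dots> \<le> g0 \<omega> * of_nat (K + 1)"
      by (intro mult_left_mono of_nat_mono Y qw) auto
    finally show "(\<Sum>x\<in>X. g0 \<omega> * of_bool (Y x (A \<omega>))) \<le> of_nat (K + 1) * g0 \<omega>"
      by (simp only: mult.commute)
  qed
  also have "\<dots> = of_nat (K + 1) * (\<integral>\<^sup>+ \<omega>. g0 \<omega> \<partial>M)"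
    by (rule nn_integral_cmult) measurable
  finally have ref: "(\<Sum>x\<in>X. \<integral>\<^sup>+ \<omega>. g0 \<omega> * of_bool (Y x (A \<omega>)) \<partial>M)
    \<le> of_nat (K + 1) * (\<integral>\<^sup>+ \<omega>. g0 \<omega> \<partial>M)" .
  have "(\<Sum>x\<in>X. \<integral>\<^sup>+ \<omega>. g x \<omega> \<partial>M) \<le> (\<Sum>x\<in>X.
      (\<integral>\<^sup>+ \<omega>. g x \<omega> * of_bool (result (P x) (A \<omega>) \<noteq> P x) \<partial>M)
          + (\<integral>\<^sup>+ \<omega>. g x \<omega> * of_nat (?N x \<omega>) \<partial>M) / of_nat K
      + (b x + a * (\<integral>\<^sup>+ \<omega>. g0 \<omega> * of_bool (Y x (A \<omega>)) \<partial>M)))"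
    by (intro sum_mono each)
  also have "\<dots> = (\<Sum>x\<in>X. (\<integral>\<^sup>+ \<omega>. g x \<omega> * of_bool (result (P x) (A \<omega>) \<noteq> P x) \<partial>M)
          + (\<integral>\<^sup>+ \<omega>. g x \<omega> * of_nat (?N x \<omega>) \<partial>M) / of_nat K)
      + (\<Sum>x\<in>X. b x) + a * (\<Sum>x\<in>X. \<integral>\<^sup>+ \<omega>. g0 \<omega> * of_bool (Y x (A \<omega>)) \<partial>M)"
    by (simp add: sum.distrib sum_distrib_left add_ac)
  also have "\<dots> \<le> (\<Sum>x\<in>X. (\<integral>\<^sup>+ \<omega>. g x \<omega> * of_bool (result (P x) (A \<omega>) \<noteq> P x) \<partial>M)
          + (\<integral>\<^sup>+ \<omega>. g x \<omega> * of_nat (?N x \<omega>) \<partial>M) / of_nat K)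
      + (\<Sum>x\<in>X. b x) + a * (of_nat (K + 1) * (\<integral>\<^sup>+ \<omega>. g0 \<omega> \<partial>M))"
    by (intro add_left_mono mult_left_mono ref) simp
  finally show ?thesis .
qed

text \<open>The map from \<open>(z, x)\<close> to \<open>(z(j := x), z j)\<close> is an involution,
  so resampling a coordinate merely weights each point by its number of resamplings.\<close>

lemma sum_resample_coordinate:
  fixes F :: "('i \<Rightarrow> 'x) \<Rightarrow> 'c::semiring_1"
  assumes "finite Z" "\<And>z. z \<in> Z \<Longrightarrow> finite {x. z(j := x) \<in> Z}"
  shows "(\<Sum>z\<in>Z. \<Sum>x | z(j := x) \<in> Z. F (z(j := x))) =
    (\<Sum>z\<in>Z. of_nat (card {x. z(j := x) \<in> Z}) * F z)"
proof -
  let ?S = "SIGMA z:Z. {x. z(j := x) \<in> Z}"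
  have "(\<Sum>z\<in>Z. \<Sum>x | z(j := x) \<in> Z. F (z(j := x))) = (\<Sum>(z, x)\<in>?S. F (z(j := x)))"
    using assms by (subst sum.Sigma) auto
  also have "\<dots> = (\<Sum>(z, x)\<in>?S. F z)"
    by (rule sum.reindex_bij_witness[where i = "\<lambda>(z, x). (z(j := x), z j)"
          and j = "\<lambda>(z, x). (z(j := x), z j)"]) auto
  also have "\<dots> = (\<Sum>z\<in>Z. \<Sum>x | z(j := x) \<in> Z. F z)"
    using assms by (subst sum.Sigma) auto
  finally show ?thesis by simp
qed

section \<open>Change of measure for the side information\<close>

text \<open>This is \<open>1 + u \<le> exp u\<close> at \<open>u = y - h\<close>, multiplied by
  \<open>q\<close>.\<close>

lemma fenchel_young_exp:
  fixes q h y :: real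
  assumes "0 \<le> q" "q \<noteq> 0 \<Longrightarrow> h = ln q"
  shows "q * y \<le> q * h - q + exp y"
proof (cases "q = 0")
  case False
  then have q: "0 < q" using assms by simp
  have "1 + (y - h) \<le> exp (y - h)"
    by (rule exp_ge_add_one_self)
  then have "q * (1 + (y - h)) \<le> q * exp (y - h)"
    using q by (intro mult_left_mono) auto
  also have "q * exp (y - h) = exp y"
    using q assms(2) False by (simp add: exp_diff)
  finally show ?thesis by (simp add: algebra_simps)
qed simp

text \<open>The Donsker--Varadhan inequality for a multiple of an indicator function; \<open>h\<close> is the
  log-likelihood ratio, with its value left open where the density vanishes.\<close>

lemma measure_le_divergence:
  fixes q h :: "'a \<Rightarrow> real"
  assumes "prob_space Q" "prob_space (density Q q)"
    and [measurable]: "q \<in> borel_measurable Q" "h \<in> borel_measurable Q" "X \<in> sets Q"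
    and q: "\<And>x. 0 \<le> q x" "\<And>x. q x \<noteq> 0 \<Longrightarrow> h x = ln (q x)"
    and h: "integrable (density Q q) h"
  shows "l * measure (density Q q) X \<le> (\<integral>x. h x \<partial>density Q q) + (exp l - 1) * measure Q X"
proof -
  interpret Q: prob_space Q by fact
  interpret P: prob_space "density Q q" by fact
  have i1: "integrable Q (\<lambda>x. q x * h x)"
    using h by (subst (asm) integrable_density) (auto simp: q)
  have "integrable (density Q q) (\<lambda>x. 1::real)" by simp
  then have i2: "integrable Q q"
    by (subst (asm) integrable_density) (auto simp: q)
  have iX: "integrable (density Q q) (\<lambda>x. indicator X x :: real)"
    by (rule integrable_real_indicator) (auto simp: less_top[symmetric])
  have i3: "integrable Q (\<lambda>x. q x * indicator X x)"
    using iX by (subst (asm) integrable_density) (auto simp: q)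
  have i4: "integrable Q (\<lambda>x. indicator X x :: real)"
    by (rule integrable_real_indicator) (auto simp: less_top[symmetric])
  have one: "(\<integral>x. q x \<partial>Q) = 1"
  proof -
    have "(\<integral>x. 1 \<partial>density Q q) = (\<integral>x. q x *\<^sub>R (1::real) \<partial>Q)"
      by (rule integral_density) (auto simp: q)
    moreover have "(\<integral>x. 1 \<partial>density Q q) = (1::real)"
      using P.prob_space by simp
    ultimately show ?thesis by simp
  qed
  have "l * measure (density Q q) X = l * (\<integral>x. indicator X x \<partial>density Q q)"
    by simp
  also have "(\<integral>x. (indicator X x::real) \<partial>density Q q) = (\<integral>x. q x *\<^sub>R indicator X x \<partial>Q)"
    by (rule integral_density) (auto simp: q)
  also have "l * \<dots> = (\<integral>x. l * (q x * indicator X x) \<partial>Q)"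
    by simp
  \<comment> \<open>Young's inequality is used with exponent \<open>l * indicator X x\<close>, whose
    exponential is \<open>1 + (exp l - 1) * indicator X x\<close>.\<close>
  also have "\<dots> \<le> (\<integral>x. (q x * h x - q x) + (1 + (exp l - 1) * indicator X x) \<partial>Q)"
  proof (rule integral_mono)
    show "integrable Q (\<lambda>x. l * (q x * indicator X x))" using i3 by simp
    show "integrable Q (\<lambda>x. (q x * h x - q x) + (1 + (exp l - 1) * indicator X x))"
      using i1 i2 i4 by simp
    fix x
    show "l * (q x * indicator X x) \<le> (q x * h x - q x) + (1 + (exp l - 1) * indicator X x)"
      using fenchel_young_exp[OF q(1) q(2), of x "l * indicator X x"]
      by (cases "x \<in> X") (auto simp: algebra_simps)
  qed
  also have "\<dots> = (\<integral>x. q x * h x \<partial>Q) - (\<integral>x. q x \<partial>Q) + (1 + (exp l - 1) * measure Q X)"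
    using i1 i2 i4 by (simp add: Q.prob_space)
  also have "(\<integral>x. q x * h x \<partial>Q) = (\<integral>x. h x \<partial>density Q q)"
    by (subst integral_density) (auto simp: q)
  finally show ?thesis using one by simp
qed

text \<open>A finite bound excludes the infinite branch of \<open>KL\<close>, which leaves absolute
  continuity and integrability of the log-density. The Radon-Nikodym derivative is finite almost
  everywhere, so its real-valued version is still a density.\<close>

lemma KL_le_imp_density:
  assumes P: "distribution_on_unit P" and Q: "distribution_on_unit Q" and KL: "KL P Q \<le> ennreal d" "0 \<le> d"
  obtains l :: "real \<Rightarrow> real" where "l \<in> borel_measurable borel" "\<And>x. 0 \<le> l x"
    "P = density Q l" "integrable P (\<lambda>x. ln (l x))" "(\<integral>x. ln (l x) \<partial>P) \<le> d"
proof -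
  interpret P: prob_space P using P by (simp add: distribution_on_unit_def)
  interpret Q: prob_space Q using Q by (simp add: distribution_on_unit_def)
  have sets: "sets P = sets borel" "sets Q = sets borel"
    using P Q by (auto simp: distribution_on_unit_def)
  have ac: "absolutely_continuous Q P" and int: "integrable P (entropy_density (exp 1) Q P)"
    using KL by (auto simp: KL_def top_unique split: if_splits)
  define l where "l x = enn2real (RN_deriv Q P x)" for x
  have l[measurable]: "l \<in> borel_measurable Q" unfolding l_def by measurable
  have e: "entropy_density (exp 1) Q P = (\<lambda>x. ln (l x))"
    by (auto simp: entropy_density_def l_def fun_eq_iff log_def)
  have "AE x in Q. RN_deriv Q P x \<noteq> \<infinity>"
    by (rule Q.RN_deriv_finite) (auto simp: ac sets P.sigma_finite_measure_axioms)
  then have "density Q (\<lambda>x. ennreal (l x)) = density Q (RN_deriv Q P)"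
    by (intro density_cong) (auto simp: l_def less_top)
  also have "\<dots> = P"
    by (rule Q.density_RN_deriv) (auto simp: ac sets)
  finally have "P = density Q (\<lambda>x. ennreal (l x))" ..
  moreover have "(\<integral>x. ln (l x) \<partial>P) \<le> d"
    using KL ac int by (auto simp: KL_def KL_divergence_def e ennreal_le_iff2)
  moreover have "l \<in> borel_measurable borel"
    using l measurable_cong_sets[OF sets(2) refl] by blast
  moreover have "0 \<le> l x" for x by (simp add: l_def)
  ultimately show ?thesis
    using int that[of l] unfolding e by blast
qed

section \<open>Likelihoods on a common probability space\<close>

locale weighted_pairs =
  fixes f_plus f_minus :: "real measure" and l :: "real \<Rightarrow> real"
  assumes prob_plus: "prob_space f_plus" and prob_minus: "prob_space f_minus"
    and sets_minus: "sets f_minus = sets borel"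
    and l_meas[measurable]: "l \<in> borel_measurable borel"
    and l_nonneg: "0 \<le> l x"
    and plus_eq: "f_plus = density f_minus l"
begin

text \<open>With every weight drawn from \<open>f_minus\<close> as the dominating law, the side
  information of each clustering is a density on this one space, and events can be compared between
  clusterings.\<close>

definition base :: "nat \<Rightarrow> (nat set \<Rightarrow> real) measure" where
  "base n = (\<Pi>\<^sub>M e\<in>vertex_pairs n. f_minus)"

definition likelihood :: "nat \<Rightarrow> nat set set \<Rightarrow> (nat set \<Rightarrow> real) \<Rightarrow> ennreal" where
  "likelihood n P W = (\<Prod>e | e \<in> vertex_pairs n \<and> same_cluster P e. ennreal (l (W e)))"

sublocale minus: prob_space f_minus by (rule prob_minus)
sublocale plus: prob_space f_plus by (rule prob_plus)

lemma sets_plus: "sets f_plus = sets borel"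
  by (simp add: plus_eq sets_minus)

lemma sets_base: "sets (base n) = sets (\<Pi>\<^sub>M e\<in>vertex_pairs n. borel)"
  unfolding base_def by (intro sets_PiM_cong) (auto simp: sets_minus)

lemma component_measurable: "e \<in> vertex_pairs n \<Longrightarrow> (\<lambda>W. W e) \<in> borel_measurable (base n)"
  by (subst measurable_cong_sets[OF sets_base refl]) (rule measurable_component_singleton)

lemma nn_integral_minus_l: "(\<integral>\<^sup>+ x. ennreal (l x) \<partial>f_minus) = 1"
proof -
  have [measurable]: "l \<in> borel_measurable f_minus"
    using l_meas by (simp cong: measurable_cong_sets add: sets_minus)
  show ?thesis
    using plus.emeasure_space_1 by (simp add: plus_eq emeasure_density)
qed

text \<open>Independence of the weights; pairs outside \<open>E\<close> receive the factor 1, which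
  integrates to 1.\<close>

lemma nn_integral_base_prod:
  assumes "E \<subseteq> vertex_pairs n" "\<And>e. e \<in> E \<Longrightarrow> g e \<in> borel_measurable borel"
  shows "(\<integral>\<^sup>+ W. (\<Prod>e\<in>E. g e (W e)) \<partial>base n) = (\<Prod>e\<in>E. \<integral>\<^sup>+ x. g e x \<partial>f_minus)"
proof -
  interpret product_sigma_finite "\<lambda>_. f_minus" by standard
  let ?g = "\<lambda>e x. if e \<in> E then g e x else 1"
  have meas: "?g e \<in> borel_measurable f_minus" for e
    using assms(2)[of e] by (cases "e \<in> E") (simp_all add: sets_minus cong: measurable_cong_sets)
  have E: "vertex_pairs n \<inter> E = E" using assms by auto
  have "(\<integral>\<^sup>+ W. (\<Prod>e\<in>E. g e (W e)) \<partial>base n) =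
      (\<integral>\<^sup>+ W. (\<Prod>e\<in>vertex_pairs n. ?g e (W e)) \<partial>base n)"
    by (simp add: prod.If_cases finite_vertex_pairs Int_def[symmetric] E)
  also have "\<dots> = (\<Prod>e\<in>vertex_pairs n. \<integral>\<^sup>+ x. ?g e x \<partial>f_minus)"
    unfolding base_def
    by (rule product_nn_integral_prod[OF finite_vertex_pairs meas])
  also have "\<dots> = (\<Prod>e\<in>vertex_pairs n. if e \<in> E then \<integral>\<^sup>+ x. g e x \<partial>f_minus else 1)"
    by (intro prod.cong) (auto simp: minus.emeasure_space_1)
  also have "\<dots> = (\<Prod>e\<in>E. \<integral>\<^sup>+ x. g e x \<partial>f_minus)"
    by (simp add: prod.If_cases finite_vertex_pairs E)
  finally show ?thesis .
qed

lemma likelihood_measurable[measurable]: "likelihood n P \<in> borel_measurable (base n)"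
  unfolding likelihood_def
  by (intro borel_measurable_prod_ennreal measurable_compose[OF component_measurable]) (simp, measurable)

text \<open>A finite product measure is determined by its values on boxes, and there both the
  indicator and the likelihood split into one factor per pair.\<close>

lemma side_information_eq_density:
  "side_information f_plus f_minus n P = density (base n) (likelihood n P)"
proof -
  let ?M = "\<lambda>e. if same_cluster P e then f_plus else f_minus"
  interpret product_sigma_finite ?M
    by (simp add: product_sigma_finite_def plus.sigma_finite_measure_axioms
        minus.sigma_finite_measure_axioms)
  have "density (base n) (likelihood n P) = (\<Pi>\<^sub>M e\<in>vertex_pairs n. ?M e)"
  proof (rule PiM_eqI)
    show "sets (density (base n) (likelihood n P)) = sets (\<Pi>\<^sub>M e\<in>vertex_pairs n. ?M e)"
      unfolding sets_density sets_base by (intro sets_PiM_cong) (simp_all add: sets_plus sets_minus)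
    fix A assume A: "\<And>e. e \<in> vertex_pairs n \<Longrightarrow> A e \<in> sets (?M e)"
    then have A': "A e \<in> sets borel" if "e \<in> vertex_pairs n" for e
      using A[OF that] by (cases "same_cluster P e") (simp_all add: sets_plus sets_minus)
    have box: "(\<Pi>\<^sub>E e\<in>vertex_pairs n. A e) \<in> sets (base n)"
      unfolding sets_base by (intro sets_PiM_I_finite finite_vertex_pairs A') auto
    have "emeasure (density (base n) (likelihood n P)) (\<Pi>\<^sub>E e\<in>vertex_pairs n. A e) =
       (\<integral>\<^sup>+ W. likelihood n P W * indicator (\<Pi>\<^sub>E e\<in>vertex_pairs n. A e) W \<partial>base n)"
      by (rule emeasure_density) (use box in auto)
    also have "\<dots> = (\<integral>\<^sup>+ W. (\<Prod>e\<in>vertex_pairs n.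
        (if same_cluster P e then ennreal (l (W e)) else 1) * indicator (A e) (W e)) \<partial>base n)"
    proof (rule nn_integral_cong)
      fix W assume "W \<in> space (base n)"
      then have "W \<in> extensional (vertex_pairs n)"
        by (auto simp: base_def space_PiM PiE_def)
      then have "indicator (\<Pi>\<^sub>E e\<in>vertex_pairs n. A e) W =
          (\<Prod>e\<in>vertex_pairs n. indicator (A e) (W e) :: ennreal)"
        by (auto simp: indicator_def PiE_def Pi_def finite_vertex_pairs prod_zero_iff)
      then show "likelihood n P W * indicator (\<Pi>\<^sub>E e\<in>vertex_pairs n. A e) W =
        (\<Prod>e\<in>vertex_pairs n.
          (if same_cluster P e then ennreal (l (W e)) else 1) * indicator (A e) (W e))"
        by (simp add: prod.distrib likelihood_def prod.If_cases finite_vertex_pairs Int_def)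
    qed
    also have "\<dots> = (\<Prod>e\<in>vertex_pairs n.
        \<integral>\<^sup>+ x. (if same_cluster P e then ennreal (l x) else 1) * indicator (A e) x \<partial>f_minus)"
      by (rule nn_integral_base_prod) (use A' in auto)
    also have "\<dots> = (\<Prod>e\<in>vertex_pairs n. emeasure (?M e) (A e))"
    proof (rule prod.cong[OF refl])
      fix e assume "e \<in> vertex_pairs n"
      with A' have e: "A e \<in> sets f_minus" by (simp add: sets_minus)
      have [measurable]: "l \<in> borel_measurable f_minus"
        using l_meas by (simp cong: measurable_cong_sets add: sets_minus)
      from e show "(\<integral>\<^sup>+ x. (if same_cluster P e then ennreal (l x) else 1) * indicator (A e) x \<partial>f_minus)
          = emeasure (?M e) (A e)"
        by (auto simp: plus_eq emeasure_density)
    qed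
    finally show "emeasure (density (base n) (likelihood n P)) (\<Pi>\<^sub>E e\<in>vertex_pairs n. A e) =
      (\<Prod>e\<in>vertex_pairs n. emeasure (?M e) (A e))" .
  qed (rule finite_vertex_pairs)
  then show ?thesis by (simp add: side_information_def)
qed

lemma prob_space_base: "prob_space (base n)"
  unfolding base_def by (intro prob_space_PiM prob_minus)

lemma prob_space_side_information: "prob_space (side_information f_plus f_minus n P)"
  unfolding side_information_def by (intro prob_space_PiM) (auto simp: prob_minus prob_plus)

lemma pair_side_information_eq_density:
  assumes "prob_space R"
  shows "R \<Otimes>\<^sub>M side_information f_plus f_minus n P =
    density (R \<Otimes>\<^sub>M base n) (\<lambda>\<omega>. likelihood n P (snd \<omega>))"
proof -
  have "density R (\<lambda>_. 1) \<Otimes>\<^sub>M density (base n) (likelihood n P) =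
    density (R \<Otimes>\<^sub>M base n) (\<lambda>(x, y). 1 * likelihood n P y)"
    using prob_space_base prob_space_side_information
    by (intro pair_measure_density)
       (auto simp: side_information_eq_density[symmetric] intro: prob_space_imp_sigma_finite)
  then show ?thesis
    by (simp add: side_information_eq_density density_1 split_beta')
qed

lemma algorithm_measurable:
  assumes "clustering_algorithm R A"
  shows "(\<lambda>\<omega>. A n (fst \<omega>) (snd \<omega>)) \<in> R \<Otimes>\<^sub>M base n \<rightarrow>\<^sub>M count_space UNIV"
proof -
  have "(\<lambda>(r, W). A n r W) \<in> R \<Otimes>\<^sub>M (\<Pi>\<^sub>M e\<in>vertex_pairs n. borel) \<rightarrow>\<^sub>M count_space UNIV"
    using assms by (simp add: clustering_algorithm_def)
  moreover have s: "sets (R \<Otimes>\<^sub>M base n) = sets (R \<Otimes>\<^sub>M (\<Pi>\<^sub>M e\<in>vertex_pairs n. borel))"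
    by (rule sets_pair_measure_cong[OF refl sets_base])
  ultimately show ?thesis
    unfolding measurable_cong_sets[OF s refl] by (simp add: split_beta')
qed

lemma algorithm_compose_measurable:
  assumes "clustering_algorithm R A"
  shows "(\<lambda>\<omega>. h (A n (fst \<omega>) (snd \<omega>))) \<in> borel_measurable (R \<Otimes>\<^sub>M base n)"
  by (rule measurable_compose[OF algorithm_measurable[OF assms]]) simp

lemma likelihood_snd_measurable[measurable]:
  "(\<lambda>\<omega>. likelihood n P (snd \<omega>)) \<in> borel_measurable (R \<Otimes>\<^sub>M base n)"
  by (rule measurable_compose[OF measurable_snd likelihood_measurable])

lemma prob_space_pair_side_information:
  "prob_space R \<Longrightarrow> prob_space (R \<Otimes>\<^sub>M side_information f_plus f_minus n P)"
  by (intro prob_space_pair prob_space_side_information)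

lemma nn_integral_likelihood:
  assumes "prob_space R"
  shows "(\<integral>\<^sup>+ \<omega>. likelihood n P (snd \<omega>) \<partial>(R \<Otimes>\<^sub>M base n)) = 1"
proof -
  interpret prob_space "R \<Otimes>\<^sub>M side_information f_plus f_minus n P"
    by (rule prob_space_pair_side_information[OF assms])
  show ?thesis
    using emeasure_space_1 unfolding pair_side_information_eq_density[OF assms]
    by (simp add: emeasure_density cong: nn_integral_cong)
qed

lemma expected_queries_eq:
  assumes "clustering_algorithm R A"
  shows "expected_queries f_plus f_minus R A n P =
    (\<integral>\<^sup>+ \<omega>. likelihood n P (snd \<omega>) * of_nat (num_queries P (A n (fst \<omega>) (snd \<omega>)))
      \<partial>(R \<Otimes>\<^sub>M base n))"
proof -
  have R: "prob_space R" using assms by (simp add: clustering_algorithm_def)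
  show ?thesis
    unfolding expected_queries_def pair_side_information_eq_density[OF R] split_beta'
    using algorithm_compose_measurable[OF assms, of "\<lambda>t. of_nat (num_queries P t)"]
    by (subst nn_integral_density) auto
qed

lemma failure_prob_eq:
  assumes "clustering_algorithm R A"
  shows "ennreal (failure_prob f_plus f_minus R A n P) =
    (\<integral>\<^sup>+ \<omega>. likelihood n P (snd \<omega>) * of_bool (result P (A n (fst \<omega>) (snd \<omega>)) \<noteq> P)
      \<partial>(R \<Otimes>\<^sub>M base n))"
proof -
  have R: "prob_space R" using assms by (simp add: clustering_algorithm_def)
  let ?M = "R \<Otimes>\<^sub>M base n"
  let ?F = "{\<omega>\<in>space ?M. result P (A n (fst \<omega>) (snd \<omega>)) \<noteq> P}"
  interpret L: prob_space "density ?M (\<lambda>\<omega>. likelihood n P (snd \<omega>))"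
    using prob_space_pair_side_information[OF R] by (simp add: pair_side_information_eq_density[OF R])
  have F: "?F \<in> sets ?M"
    using measurable_sets[OF algorithm_measurable[OF assms], of "{t. result P t \<noteq> P}" n]
    by (simp add: vimage_def Int_def conj_commute)
  have "failure_prob f_plus f_minus R A n P =
      measure (density ?M (\<lambda>\<omega>. likelihood n P (snd \<omega>))) ?F"
    unfolding failure_prob_def pair_side_information_eq_density[OF R] by (simp add: split_beta')
  then have "ennreal (failure_prob f_plus f_minus R A n P) =
      emeasure (density ?M (\<lambda>\<omega>. likelihood n P (snd \<omega>))) ?F"
    by (simp add: L.emeasure_eq_measure)
  also have "\<dots> = (\<integral>\<^sup>+ \<omega>. likelihood n P (snd \<omega>) * indicator ?F \<omega> \<partial>?M)"
    using F by (intro emeasure_density) auto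
  also have "\<dots> = (\<integral>\<^sup>+ \<omega>. likelihood n P (snd \<omega>) * of_bool (result P (A n (fst \<omega>) (snd \<omega>)) \<noteq> P) \<partial>?M)"
    by (intro nn_integral_cong) (auto simp: indicator_def)
  finally show ?thesis .
qed

text \<open>It turns the expected log-density of a weight within a cluster into an integral under
  \<open>f_plus\<close>, that is, into D(f_plus || f_minus).\<close>

lemma distr_pair_component:
  assumes "prob_space R" "e \<in> vertex_pairs n" "same_cluster P e"
  shows "distr (R \<Otimes>\<^sub>M side_information f_plus f_minus n P) f_plus (\<lambda>\<omega>. snd \<omega> e) = f_plus"
proof -
  interpret R: prob_space R by fact
  let ?N = "side_information f_plus f_minus n P"
  interpret N: prob_space ?N by (rule prob_space_side_information)
  have m: "(\<lambda>W. W e) \<in> ?N \<rightarrow>\<^sub>M f_plus"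
    unfolding side_information_def
    using measurable_component_singleton[OF assms(2), of "\<lambda>e. if same_cluster P e then f_plus else f_minus"]
      assms(3) by simp
  have c: "distr ?N f_plus (\<lambda>W. W e) = f_plus"
    using distr_PiM_component[of "vertex_pairs n" "\<lambda>e. if same_cluster P e then f_plus else f_minus" e]
      assms prob_plus prob_minus by (simp add: side_information_def)
  show ?thesis
  proof (rule measure_eqI)
    fix X assume "X \<in> sets (distr (R \<Otimes>\<^sub>M ?N) f_plus (\<lambda>\<omega>. snd \<omega> e))"
    then have X: "X \<in> sets f_plus" by simp
    have "(\<lambda>\<omega>. snd \<omega> e) -` X \<inter> space (R \<Otimes>\<^sub>M ?N) = space R \<times> ((\<lambda>W. W e) -` X \<inter> space ?N)"
      by (auto simp: space_pair_measure)
    then have "emeasure (distr (R \<Otimes>\<^sub>M ?N) f_plus (\<lambda>\<omega>. snd \<omega> e)) X =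
        emeasure (R \<Otimes>\<^sub>M ?N) (space R \<times> ((\<lambda>W. W e) -` X \<inter> space ?N))"
      using emeasure_distr[OF measurable_compose[OF measurable_snd[of R] m] X] by simp
    also have "\<dots> = emeasure ?N ((\<lambda>W. W e) -` X \<inter> space ?N)"
      using measurable_sets[OF m X]
      by (subst N.emeasure_pair_measure_Times) (auto simp: R.emeasure_space_1)
    also have "\<dots> = emeasure f_plus X"
      using emeasure_distr[OF m X] c by simp
    finally show "emeasure (distr (R \<Otimes>\<^sub>M ?N) f_plus (\<lambda>\<omega>. snd \<omega> e)) X = emeasure f_plus X" .
  qed simp
qed

text \<open>The two laws differ only on \<open>S\<close>. Their density ratio is the product of
  \<open>l\<close> over \<open>S\<close>, and its logarithm has expectation \<open>card S\<close>
  times the divergence of one pair. Applying \<open>measure_le_divergence\<close> with parameter 1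
  gives the factor \<open>exp 1 - 1\<close>.\<close>

lemma merge_measure_le:
  fixes R :: "'a measure"
  assumes R: "prob_space R" and S: "S \<subseteq> vertex_pairs n"
    and same: "\<And>e. e \<in> vertex_pairs n \<Longrightarrow> same_cluster P e \<longleftrightarrow> same_cluster P0 e \<or> e \<in> S"
    and sep: "\<And>e. e \<in> S \<Longrightarrow> \<not> same_cluster P0 e"
    and int: "integrable f_plus (\<lambda>x. ln (l x))" and d: "(\<integral>x. ln (l x) \<partial>f_plus) \<le> d" "0 \<le> d"
    and Y: "Y \<in> sets (R \<Otimes>\<^sub>M base n)"
  shows "(\<integral>\<^sup>+ \<omega>. likelihood n P (snd \<omega>) * indicator Y \<omega> \<partial>(R \<Otimes>\<^sub>M base n))
    \<le> ennreal (real (card S) * d)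
      + ennreal (exp 1 - 1) * (\<integral>\<^sup>+ \<omega>. likelihood n P0 (snd \<omega>) * indicator Y \<omega> \<partial>(R \<Otimes>\<^sub>M base n))"
proof -
  let ?M = "R \<Otimes>\<^sub>M base n"
  define L where "L P = density ?M (\<lambda>\<omega>. likelihood n P (snd \<omega>))" for P
  define q h :: "'a \<times> (nat set \<Rightarrow> real) \<Rightarrow> real" where
    "q \<omega> = (\<Prod>e\<in>S. l (snd \<omega> e))" and "h \<omega> = (\<Sum>e\<in>S. ln (l (snd \<omega> e)))" for \<omega>
  have finS: "finite S" using S finite_vertex_pairs finite_subset by blast
  have comp: "(\<lambda>\<omega>. snd \<omega> e) \<in> borel_measurable ?M" if "e \<in> S" for e
    using S that by (intro measurable_compose[OF measurable_snd component_measurable]) auto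
  have q_meas: "q \<in> borel_measurable ?M"
    unfolding q_def by (intro borel_measurable_prod measurable_compose[OF comp l_meas])
  have h_meas: "h \<in> borel_measurable ?M"
    unfolding h_def
    by (intro borel_measurable_sum borel_measurable_ln measurable_compose[OF comp l_meas])
  have q0: "0 \<le> q \<omega>" for \<omega>
    unfolding q_def by (intro prod_nonneg ballI l_nonneg)
  \<comment> \<open>If a factor vanishes, the sum of logarithms is still a finite number and need
    not be the logarithm of the product.\<close>
  have qh: "h \<omega> = ln (q \<omega>)" if "q \<omega> \<noteq> 0" for \<omega>
  proof -
    have pos: "0 < l (snd \<omega> e)" if "e \<in> S" for e
      using \<open>q \<omega> \<noteq> 0\<close> that finS l_nonneg[of "snd \<omega> e"] by (auto simp: q_def prod_zero_iff less_le)
    then show ?thesis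
      unfolding q_def h_def by (subst ln_prod) (auto simp: finS dest!: pos)
  qed
  have L: "L P' = R \<Otimes>\<^sub>M side_information f_plus f_minus n P'" for P'
    unfolding L_def by (rule pair_side_information_eq_density[OF R, symmetric])
  have LP: "L P = density (L P0) q"
  proof -
    have "likelihood n P W = likelihood n P0 W * (\<Prod>e\<in>S. ennreal (l (W e)))" for W
    proof -
      have "{e. e \<in> vertex_pairs n \<and> same_cluster P e} =
          {e. e \<in> vertex_pairs n \<and> same_cluster P0 e} \<union> S"
        using same S by auto
      moreover have "{e. e \<in> vertex_pairs n \<and> same_cluster P0 e} \<inter> S = {}"
        using sep by auto
      ultimately show ?thesis
        using finS finite_vertex_pairs by (simp add: likelihood_def prod.union_disjoint)
    qed
    then show ?thesis
      unfolding L_def q_def using q_meas[unfolded q_def]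
      by (subst density_density_eq) (auto simp: prod_ennreal l_nonneg)
  qed
  interpret L0: prob_space "L P0" unfolding L by (rule prob_space_pair_side_information[OF R])
  interpret L1: prob_space "L P" unfolding L by (rule prob_space_pair_side_information[OF R])
  have comp_int: "integrable (L P) (\<lambda>\<omega>. ln (l (snd \<omega> e)))"
    "(\<integral>\<omega>. ln (l (snd \<omega> e)) \<partial>L P) = (\<integral>x. ln (l x) \<partial>f_plus)" if "e \<in> S" for e
  proof -
    have e: "e \<in> vertex_pairs n" "same_cluster P e" using that S same by auto
    note D = distr_pair_component[OF R e, folded L]
    have m: "(\<lambda>\<omega>. snd \<omega> e) \<in> L P \<rightarrow>\<^sub>M f_plus"
      using comp[OF that] by (simp add: L_def sets_plus cong: measurable_cong_sets)
    have f: "(\<lambda>x. ln (l x)) \<in> borel_measurable f_plus"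
      using int by (rule borel_measurable_integrable)
    show "integrable (L P) (\<lambda>\<omega>. ln (l (snd \<omega> e)))"
      using integrable_distr_eq[OF m f] int unfolding D by blast
    show "(\<integral>\<omega>. ln (l (snd \<omega> e)) \<partial>L P) = (\<integral>x. ln (l x) \<partial>f_plus)"
      using integral_distr[OF m f] unfolding D by simp
  qed
  have hL: "integrable (L P) h"
    unfolding h_def by (intro Bochner_Integration.integrable_sum comp_int)
  have "(\<integral>\<omega>. h \<omega> \<partial>L P) = (\<Sum>e\<in>S. \<integral>\<omega>. ln (l (snd \<omega> e)) \<partial>L P)"
    unfolding h_def by (intro Bochner_Integration.integral_sum comp_int)
  also have "\<dots> = real (card S) * (\<integral>x. ln (l x) \<partial>f_plus)"
    by (simp add: comp_int)
  also have "\<dots> \<le> real (card S) * d"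
    using d by (intro mult_left_mono) auto
  finally have hd: "(\<integral>\<omega>. h \<omega> \<partial>L P) \<le> real (card S) * d" .
  have YL: "Y \<in> sets (L P0)" using Y by (simp add: L_def)
  have "1 * measure (density (L P0) q) Y \<le>
      (\<integral>\<omega>. h \<omega> \<partial>density (L P0) q) + (exp 1 - 1) * measure (L P0) Y"
  proof (rule measure_le_divergence)
    show "prob_space (L P0)" by (rule L0.prob_space_axioms)
    show "prob_space (density (L P0) q)" unfolding LP[symmetric] by (rule L1.prob_space_axioms)
    show "q \<in> borel_measurable (L P0)" "h \<in> borel_measurable (L P0)"
      using q_meas h_meas by (simp_all add: L_def)
    show "integrable (density (L P0) q) h" using hL by (simp add: LP)
  qed (use YL q0 qh in auto)
  then have "measure (L P) Y \<le> real (card S) * d + (exp 1 - 1) * measure (L P0) Y"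
    using hd by (simp add: LP)
  then have "ennreal (measure (L P) Y) \<le> ennreal (real (card S) * d + (exp 1 - 1) * measure (L P0) Y)"
    by (rule ennreal_leI)
  also have "\<dots> = ennreal (real (card S) * d) + ennreal ((exp 1 - 1) * measure (L P0) Y)"
    using d by (intro ennreal_plus) auto
  finally have "emeasure (L P) Y \<le> ennreal (real (card S) * d) + ennreal (exp 1 - 1) * emeasure (L P0) Y"
    by (simp add: L0.emeasure_eq_measure L1.emeasure_eq_measure ennreal_mult'')
  then show ?thesis
    using Y by (simp add: L_def emeasure_density)
qed

end

section \<open>Uniformly placed vertices\<close>

text \<open>Only attained labels are used, so no cluster is empty and clusters correspond to
  attained labels.\<close>

definition labelled_clusters :: "nat \<Rightarrow> (nat \<Rightarrow> nat) \<Rightarrow> nat set set" where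
  "labelled_clusters n f = (\<lambda>c. {u\<in>{1..n}. f u = c}) ` f ` {1..n}"

lemma labelled_clusters_in_clusterings:
  "labelled_clusters n f \<in> clusterings n (card (f ` {1..n}))"
proof -
  have "inj_on (\<lambda>c. {u\<in>{1..n}. f u = c}) (f ` {1..n})"
  proof (rule inj_onI)
    fix c c' assume c: "c \<in> f ` {1..n}" and eq: "{u\<in>{1..n}. f u = c} = {u\<in>{1..n}. f u = c'}"
    from c obtain u where "u \<in> {u\<in>{1..n}. f u = c}" by blast
    then show "c = c'" using eq by blast
  qed
  then show ?thesis
    by (auto simp: clusterings_def labelled_clusters_def card_image partition_on_def disjoint_def)
qed

lemma same_cluster_labelled:
  assumes "u \<in> {1..n}" "w \<in> {1..n}"
  shows "same_cluster (labelled_clusters n f) {u, w} \<longleftrightarrow> f u = f w"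
  using assms by (auto simp: same_cluster_def labelled_clusters_def)

text \<open>These are the pairs that become joined when \<open>v\<close>, previously alone, enters
  the cluster labelled \<open>i\<close>.\<close>

definition star :: "nat \<Rightarrow> (nat \<Rightarrow> nat) \<Rightarrow> nat \<Rightarrow> nat \<Rightarrow> nat set set" where
  "star n f v i = (\<lambda>u. {v, u}) ` {u\<in>{1..n} - {v}. f u = i}"

lemma star_subset: "v \<in> {1..n} \<Longrightarrow> star n f v i \<subseteq> vertex_pairs n \<inter> {e. v \<in> e}"
  by (auto simp: star_def vertex_pairs_def)

lemma disjoint_family_star: "disjoint_family_on (star n f v) X"
  by (auto simp: disjoint_family_on_def star_def doubleton_eq_iff)

text \<open>Stars with different labels reach different vertices. Over all destinations of
  \<open>v\<close> the divergence thus adds up to at most \<open>n * d\<close>, although a single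
  cluster may be large.\<close>

lemma sum_card_star_le: "(\<Sum>i\<in>{1..k}. card (star n f v i)) \<le> n"
proof -
  have "(\<Sum>i\<in>{1..k}. card (star n f v i)) \<le> (\<Sum>i\<in>{1..k}. card {u\<in>{1..n} - {v}. f u = i})"
    unfolding star_def by (intro sum_mono card_image_le) auto
  also have "\<dots> = card (\<Union>i\<in>{1..k}. {u\<in>{1..n} - {v}. f u = i})"
    by (subst card_UN_disjoint) auto
  also have "\<dots> \<le> card {1..n}"
    by (intro card_mono) auto
  finally show ?thesis by simp
qed

text \<open>A label that \<open>f\<close> does not attain leaves \<open>v\<close> alone, and pairs
  avoiding \<open>v\<close> are unaffected by its label.\<close>

lemma same_cluster_relabel:
  assumes "v \<in> {1..n}" "c \<notin> f ` {1..n}" "e \<in> vertex_pairs n"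
  shows "same_cluster (labelled_clusters n (f(v := i))) e \<longleftrightarrow>
    same_cluster (labelled_clusters n (f(v := c))) e \<or> e \<in> star n f v i"
proof -
  from assms(3) obtain u w where e: "e = {u, w}" "u \<noteq> w" "u \<in> {1..n}" "w \<in> {1..n}"
    by (auto simp: vertex_pairs_def card_2_iff)
  show ?thesis
    unfolding e(1) same_cluster_labelled[OF e(3,4)] using e assms(1,2)
    by (auto simp: star_def doubleton_eq_iff)
qed

lemma not_same_cluster_star:
  assumes "v \<in> {1..n}" "c \<notin> f ` {1..n}" "e \<in> star n f v i"
  shows "\<not> same_cluster (labelled_clusters n (f(v := c))) e"
proof -
  from assms(3) obtain u where "u \<in> {1..n}" "u \<noteq> v" "e = {v, u}"
    by (auto simp: star_def)
  with assms(1,2) show ?thesis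
    using same_cluster_labelled[of v n u "f(v := c)"] by fastforce
qed

context weighted_pairs
begin

text \<open>The hard inputs: \<open>k\<close> seeds, one per cluster, and \<open>m\<close> further vertices that are placed
  independently and uniformly. In the reference clustering one of these vertices is alone.\<close>

lemma random_assignment_bound:
  fixes p Q d :: real
  assumes alg: "clustering_algorithm R A"
    and int: "integrable f_plus (\<lambda>x. ln (l x))" and d: "(\<integral>x. ln (l x) \<partial>f_plus) \<le> d" "0 \<le> d"
    and k: "0 < k" and K: "0 < K"
    and p: "0 \<le> p" "\<And>P. P \<in> clusterings (k + m) k \<Longrightarrow>
      failure_prob f_plus f_minus R A (k + m) P \<le> p"
    and Q: "0 \<le> Q" "\<And>P. P \<in> clusterings (k + m) k \<Longrightarrow>
      expected_queries f_plus f_minus R A (k + m) P \<le> ennreal Q"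
  shows "real m * real k \<le> real k * (real m * p + 2 * Q / real K)
    + real m * (real (k + m) * d + (exp 1 - 1) * real (K + 1))"
proof -
  define n where "n = k + m"
  define V where "V = {k + 1..k + m}"
  define Z where "Z = V \<rightarrow>\<^sub>E {1..k}"
  \<comment> \<open>The vertices up to \<open>k\<close> are seeds with their own labels, so all
    \<open>k\<close> labels occur whatever \<open>s\<close> is.\<close>
  define lab where "lab s u = (if u \<le> k then u else s u)" for s :: "nat \<Rightarrow> nat" and u
  define P where "P s = labelled_clusters n (lab s)" for s
  define B where "B = R \<Otimes>\<^sub>M base n"
  define N where "N s v = (\<integral>\<^sup>+ \<omega>. likelihood n (P s) (snd \<omega>) *
      of_nat (queries_in {e. v \<in> e} (P s) (A n (fst \<omega>) (snd \<omega>))) \<partial>B)" for s v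
  define F where "F s = ennreal (failure_prob f_plus f_minus R A n (P s))" for s
  have R: "prob_space R" and qw: "\<And>\<omega>. queries_within n (A n (fst \<omega>) (snd \<omega>))"
    using alg by (auto simp: clustering_algorithm_def)
  have finZ: "finite Z" by (auto simp: Z_def V_def intro: finite_PiE)
  have labr: "lab s u \<in> {1..k}" if "s \<in> Z" "u \<in> {1..n}" for s u
    using that by (auto simp: lab_def Z_def V_def n_def PiE_def Pi_def)
  have P_in: "P s \<in> clusterings n k" if "s \<in> Z" for s
  proof -
    have "{1..k} \<subseteq> lab s ` {1..n}"
      by (auto simp: image_iff lab_def n_def intro!: bexI)
    with labr[OF that] have "lab s ` {1..n} = {1..k}" by blast
    then show ?thesis
      unfolding P_def using labelled_clusters_in_clusterings[of n "lab s"] by simp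
  qed
  have upd: "{x. s(v := x) \<in> Z} = {1..k}" if "s \<in> Z" "v \<in> V" for s v
    using that by (auto simp: Z_def PiE_def Pi_def extensional_def)
  \<comment> \<open>Only \<open>v\<close> moves while all other vertices stay fixed. The label 0 is
    never assigned, so it isolates \<open>v\<close> in the reference.\<close>
  have one: "of_nat k \<le> (\<Sum>i | s(v := i) \<in> Z. F (s(v := i)) + N (s(v := i)) v / of_nat K)
      + ennreal (real n * d + (exp 1 - 1) * real (K + 1))" if s: "s \<in> Z" and v: "v \<in> V" for s v
  proof -
    have v': "v \<in> {1..n}" "k < v" using v by (auto simp: V_def n_def)
    have fresh: "0 \<notin> lab s ` {1..n}"
      using labr[OF s] by force
    have Pv: "P (s(v := i)) = labelled_clusters n ((lab s)(v := i))" for i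
      unfolding P_def using v' by (intro arg_cong[where f = "labelled_clusters n"]) (auto simp: lab_def fun_eq_iff)
    let ?S = "star n (lab s) v"
    let ?P0 = "labelled_clusters n ((lab s)(v := 0))"
    let ?N = "\<lambda>i \<omega>. queries_in (\<Union>i\<in>{1..k}. ?S i) (P (s(v := i))) (A n (fst \<omega>) (snd \<omega>))"
    note same = same_cluster_relabel[OF v'(1) fresh]
    note sep = not_same_cluster_star[OF v'(1) fresh]
    have "(\<Sum>i\<in>{1..k}. \<integral>\<^sup>+ \<omega>. likelihood n (P (s(v := i))) (snd \<omega>) \<partial>B)
      \<le> (\<Sum>i\<in>{1..k}. (\<integral>\<^sup>+ \<omega>. likelihood n (P (s(v := i))) (snd \<omega>) *
            of_bool (result (P (s(v := i))) (A n (fst \<omega>) (snd \<omega>)) \<noteq> P (s(v := i))) \<partial>B)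
          + (\<integral>\<^sup>+ \<omega>. likelihood n (P (s(v := i))) (snd \<omega>) * of_nat (?N i \<omega>) \<partial>B) / of_nat K)
        + (\<Sum>i\<in>{1..k}. ennreal (real (card (?S i)) * d))
        + ennreal (exp 1 - 1) * (of_nat (K + 1) * (\<integral>\<^sup>+ \<omega>. likelihood n ?P0 (snd \<omega>) \<partial>B))"
      unfolding B_def
    proof (rule sum_weight_le_failure)
      show "(\<lambda>\<omega>. A n (fst \<omega>) (snd \<omega>)) \<in> R \<Otimes>\<^sub>M base n \<rightarrow>\<^sub>M count_space UNIV"
        by (rule algorithm_measurable[OF alg])
      show "disjoint_family_on ?S {1..k}" by (rule disjoint_family_star)
      show "same_cluster (P (s(v := i))) e \<longleftrightarrow> same_cluster ?P0 e \<or> e \<in> ?S i"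
        if "e \<in> vertex_pairs n" for i e
        unfolding Pv by (rule same) (use that in auto)
      show "\<exists>e\<in>?S i. e \<in> vertex_pairs n \<and> \<not> same_cluster ?P0 e" if i: "i \<in> {1..k}" for i
      proof
        \<comment> \<open>The seed of cluster \<open>i\<close> provides a neighbour of
          \<open>v\<close> there.\<close>
        show "{v, i} \<in> ?S i" using i v' by (auto simp: star_def lab_def n_def)
        then show "{v, i} \<in> vertex_pairs n \<and> \<not> same_cluster ?P0 {v, i}"
          using star_subset[OF v'(1)] sep by blast
      qed
      show "(\<integral>\<^sup>+ \<omega>. likelihood n (P (s(v := i))) (snd \<omega>) * indicator Y \<omega> \<partial>(R \<Otimes>\<^sub>M base n))
        \<le> ennreal (real (card (?S i)) * d) + ennreal (exp 1 - 1) *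
          (\<integral>\<^sup>+ \<omega>. likelihood n ?P0 (snd \<omega>) * indicator Y \<omega> \<partial>(R \<Otimes>\<^sub>M base n))"
        if "Y \<in> sets (R \<Otimes>\<^sub>M base n)" for i Y
        unfolding Pv
        by (rule merge_measure_le[OF R _ same sep int d that])
           (use star_subset[OF v'(1)] in auto)
    qed (use qw K in auto)
    also have "(\<Sum>i\<in>{1..k}. \<integral>\<^sup>+ \<omega>. likelihood n (P (s(v := i))) (snd \<omega>) \<partial>B) = of_nat k"
      by (simp add: B_def nn_integral_likelihood[OF R])
    also have "(\<integral>\<^sup>+ \<omega>. likelihood n ?P0 (snd \<omega>) \<partial>B) = 1"
      by (simp add: B_def nn_integral_likelihood[OF R])
    also have "(\<Sum>i\<in>{1..k}. ennreal (real (card (?S i)) * d)) = ennreal (\<Sum>i\<in>{1..k}. real (card (?S i)) * d)"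
      using d by (intro sum_ennreal) auto
    also have "(\<Sum>i\<in>{1..k}. real (card (?S i)) * d) = real (\<Sum>i\<in>{1..k}. card (?S i)) * d"
      by (simp add: sum_distrib_right)
    finally have "of_nat k \<le> (\<Sum>i\<in>{1..k}. (\<integral>\<^sup>+ \<omega>. likelihood n (P (s(v := i))) (snd \<omega>) *
            of_bool (result (P (s(v := i))) (A n (fst \<omega>) (snd \<omega>)) \<noteq> P (s(v := i))) \<partial>B)
          + (\<integral>\<^sup>+ \<omega>. likelihood n (P (s(v := i))) (snd \<omega>) * of_nat (?N i \<omega>) \<partial>B) / of_nat K)
        + ennreal (real (\<Sum>i\<in>{1..k}. card (?S i)) * d) + ennreal (exp 1 - 1) * (of_nat (K + 1) * 1)" .
    also have "\<dots> \<le> (\<Sum>i\<in>{1..k}. F (s(v := i)) + N (s(v := i)) v / of_nat K)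
        + ennreal (real n * d) + ennreal (exp 1 - 1) * (of_nat (K + 1) * 1)"
    proof (intro add_mono sum_mono order_refl divide_right_mono_ennreal)
      show "(\<integral>\<^sup>+ \<omega>. likelihood n (P (s(v := i))) (snd \<omega>) *
            of_bool (result (P (s(v := i))) (A n (fst \<omega>) (snd \<omega>)) \<noteq> P (s(v := i))) \<partial>B) \<le> F (s(v := i))" for i
        by (simp add: F_def failure_prob_eq[OF alg] B_def)
      show "(\<integral>\<^sup>+ \<omega>. likelihood n (P (s(v := i))) (snd \<omega>) * of_nat (?N i \<omega>) \<partial>B) \<le> N (s(v := i)) v" for i
        unfolding N_def using star_subset[OF v'(1)]
        by (intro nn_integral_mono mult_left_mono of_nat_mono queries_in_mono) auto
      show "ennreal (real (\<Sum>i\<in>{1..k}. card (?S i)) * d) \<le> ennreal (real n * d)"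
        using sum_card_star_le d(2) by (intro ennreal_leI mult_right_mono of_nat_mono) auto
    qed
    also have "\<dots> = (\<Sum>i | s(v := i) \<in> Z. F (s(v := i)) + N (s(v := i)) v / of_nat K)
      + ennreal (real n * d + (exp 1 - 1) * real (K + 1))"
    proof -
      have "ennreal (exp 1 - 1) * (of_nat (K + 1) * 1) = ennreal ((exp 1 - 1) * real (K + 1))"
        by (simp add: ennreal_mult ennreal_of_nat_eq_real_of_nat)
      then show ?thesis
        using d(2) by (simp add: upd[OF s v] ennreal_plus add.assoc)
    qed
    finally show ?thesis .
  qed
  define c where "c = real n * d + (exp 1 - 1) * real (K + 1)"
  have c0: "0 \<le> c" using d(2) by (auto simp: c_def)
  \<comment> \<open>In the sum over all \<open>s\<close>, the alternatives obtained by moving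
    \<open>v\<close> are again assignments, each occurring \<open>k\<close> times.\<close>
  have "(\<Sum>v\<in>V. \<Sum>s\<in>Z. of_nat k) \<le>
      (\<Sum>v\<in>V. \<Sum>s\<in>Z. (\<Sum>i | s(v := i) \<in> Z. F (s(v := i)) + N (s(v := i)) v / of_nat K) + ennreal c)"
    unfolding c_def by (intro sum_mono one)
  also have "\<dots> = (\<Sum>v\<in>V. \<Sum>s\<in>Z. of_nat k * (F s + N s v / of_nat K)) + (\<Sum>v\<in>V. \<Sum>s\<in>Z. ennreal c)"
  proof -
    have "(\<Sum>s\<in>Z. \<Sum>i | s(v := i) \<in> Z. F (s(v := i)) + N (s(v := i)) v / of_nat K) =
        (\<Sum>s\<in>Z. of_nat k * (F s + N s v / of_nat K))" if "v \<in> V" for v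
      using sum_resample_coordinate[OF finZ, of v "\<lambda>s. F s + N s v / of_nat K"] upd[OF _ that] by simp
    then show ?thesis by (simp add: sum.distrib)
  qed
  also have "(\<Sum>v\<in>V. \<Sum>s\<in>Z. of_nat k * (F s + N s v / of_nat K)) =
      (\<Sum>s\<in>Z. of_nat k * (\<Sum>v\<in>V. F s + N s v / of_nat K))"
    by (subst sum.swap) (simp add: sum_distrib_left)
  also have "\<dots> \<le> (\<Sum>s\<in>Z. of_nat k * ennreal (real m * p + 2 * Q / real K))"
  proof (intro sum_mono mult_left_mono)
    fix s assume s: "s \<in> Z"
    \<comment> \<open>Charging a query at both of its vertices produces the factor 2.\<close>
    have "(\<Sum>v\<in>V. N s v) = (\<integral>\<^sup>+ \<omega>. (\<Sum>v\<in>V. likelihood n (P s) (snd \<omega>) *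
      of_nat (queries_in {e. v \<in> e} (P s) (A n (fst \<omega>) (snd \<omega>)))) \<partial>B)"
      unfolding N_def B_def
      by (intro nn_integral_sum[symmetric] borel_measurable_times_ennreal likelihood_snd_measurable
          algorithm_compose_measurable[OF alg, where h = "\<lambda>t. of_nat (queries_in _ _ t)"])
    also have "\<dots> \<le> (\<integral>\<^sup>+ \<omega>. 2 * (likelihood n (P s) (snd \<omega>) *
      of_nat (num_queries (P s) (A n (fst \<omega>) (snd \<omega>)))) \<partial>B)"
    proof (rule nn_integral_mono)
      fix \<omega>
      have "(\<Sum>v\<in>V. likelihood n (P s) (snd \<omega>) * of_nat (queries_in {e. v \<in> e} (P s) (A n (fst \<omega>) (snd \<omega>))))
        = likelihood n (P s) (snd \<omega>) * of_nat (\<Sum>v\<in>V. queries_in {e. v \<in> e} (P s) (A n (fst \<omega>) (snd \<omega>)))"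
        by (simp add: sum_distrib_left)
      also have "\<dots> \<le> likelihood n (P s) (snd \<omega>) * of_nat (2 * num_queries (P s) (A n (fst \<omega>) (snd \<omega>)))"
        by (intro mult_left_mono of_nat_mono sum_queries_in_vertex_le[OF _ qw]) (auto simp: V_def)
      finally show "(\<Sum>v\<in>V. likelihood n (P s) (snd \<omega>) * of_nat (queries_in {e. v \<in> e} (P s) (A n (fst \<omega>) (snd \<omega>))))
        \<le> 2 * (likelihood n (P s) (snd \<omega>) * of_nat (num_queries (P s) (A n (fst \<omega>) (snd \<omega>))))"
        by (simp add: mult_ac)
    qed
    also have "\<dots> = 2 * expected_queries f_plus f_minus R A n (P s)"
      unfolding expected_queries_eq[OF alg] B_def
      by (intro nn_integral_cmult borel_measurable_times_ennreal likelihood_snd_measurable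
          algorithm_compose_measurable[OF alg, where h = "\<lambda>t. of_nat (num_queries _ t)"])
    also have "\<dots> \<le> 2 * ennreal Q"
      using Q(2) P_in[OF s] by (intro mult_left_mono) (auto simp: n_def)
    finally have sumN: "(\<Sum>v\<in>V. N s v) \<le> ennreal (2 * Q)"
      using Q(1) by (simp add: ennreal_mult)
    have "(\<Sum>v\<in>V. F s + N s v / of_nat K) = of_nat m * F s + (\<Sum>v\<in>V. N s v) / of_nat K"
      by (simp add: sum.distrib V_def sum_divide_distrib divide_ennreal_def sum_distrib_right)
    also have "\<dots> \<le> of_nat m * ennreal p + ennreal (2 * Q) / of_nat K"
      using p(2) P_in[OF s] sumN
      by (intro add_mono mult_left_mono divide_right_mono_ennreal) (auto simp: F_def n_def intro: ennreal_leI)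
    also have "\<dots> = ennreal (real m * p + 2 * Q / real K)"
    proof -
      have "ennreal (2 * Q) / of_nat K = ennreal (2 * Q / real K)"
        unfolding ennreal_of_nat_eq_real_of_nat using Q(1) K by (intro divide_ennreal) auto
      then show ?thesis
        using p(1) Q(1) by (simp add: ennreal_of_nat_eq_real_of_nat ennreal_mult[of "real m" p] ennreal_plus)
    qed
    finally show "(\<Sum>v\<in>V. F s + N s v / of_nat K) \<le> ennreal (real m * p + 2 * Q / real K)" .
  qed simp
  finally have "(\<Sum>v\<in>V. \<Sum>s\<in>Z. of_nat k) \<le> (\<Sum>s\<in>Z. of_nat k * ennreal (real m * p + 2 * Q / real K))
      + (\<Sum>v\<in>V. \<Sum>s\<in>Z. ennreal c)"
    by (simp add: add_right_mono)
  then have "ennreal (real m * (real (card Z) * real k)) \<le>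
      ennreal (real (card Z) * (real k * (real m * p + 2 * Q / real K)) + real m * (real (card Z) * c))"
    using c0 p(1) Q(1) K
    by (simp add: V_def ennreal_of_nat_eq_real_of_nat ennreal_mult ennreal_plus)
  then have "real m * (real (card Z) * real k) \<le>
      real (card Z) * (real k * (real m * p + 2 * Q / real K)) + real m * (real (card Z) * c)"
    using c0 p(1) Q(1) by (subst (asm) ennreal_le_iff) auto
  then have "real (card Z) * (real m * real k) \<le>
      real (card Z) * (real k * (real m * p + 2 * Q / real K) + real m * c)"
    by (simp add: algebra_simps)
  moreover have "0 < card Z"
    using k by (simp add: Z_def card_PiE V_def)
  ultimately show ?thesis
    by (simp add: c_def n_def)
qed

end

section \<open>Hidden pairs\<close>

definition pair_clusters :: "nat \<Rightarrow> nat set set \<Rightarrow> nat set set" where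
  "pair_clusters n T = T \<union> (\<lambda>u. {u}) ` ({1..n} - \<Union>T)"

text \<open>Each pair lowers the number of clusters by one compared with singletons only.\<close>

lemma pair_clusters_in_clusterings:
  assumes T: "T \<subseteq> vertex_pairs n" "disjoint T" and n: "n = k + card T"
  shows "pair_clusters n T \<in> clusterings n k"
proof -
  have fin: "finite T" using T(1) finite_vertex_pairs finite_subset by blast
  have two: "card e = 2" "finite e" "e \<subseteq> {1..n}" if "e \<in> T" for e
    using T(1) that by (auto simp: vertex_pairs_def intro: finite_subset[OF _ finite_atLeastAtMost])
  have U: "\<Union>T \<subseteq> {1..n}" using two by auto
  have "card (\<Union>T) = (\<Sum>e\<in>T. card e)"
    using T(2) two by (intro card_Union_disjoint) (auto simp: disjoint_def pairwise_def disjnt_def)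
  also have "\<dots> = 2 * card T" using two by simp
  finally have cU: "card (\<Union>T) = 2 * card T" .
  have "card (\<Union>T) \<le> n" using card_mono[OF _ U] by simp
  moreover have "card ((\<lambda>u. {u}) ` ({1..n} - \<Union>T)) = n - 2 * card T"
    using card_Diff_subset[OF finite_subset[OF U] U] cU by (subst card_image) auto
  moreover have "T \<inter> (\<lambda>u. {u}) ` ({1..n} - \<Union>T) = {}" by auto
  ultimately have "card (pair_clusters n T) = k"
    using fin n cU by (simp add: pair_clusters_def card_Un_disjoint)
  moreover have "partition_on {1..n} (pair_clusters n T)"
    unfolding partition_on_def
  proof (intro conjI)
    show "\<Union>(pair_clusters n T) = {1..n}" using U by (auto simp: pair_clusters_def)
    show "disjoint (pair_clusters n T)"
      using T(2) by (auto simp: pair_clusters_def disjoint_def)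
    show "{} \<notin> pair_clusters n T"
      using two(1)[of "{}"] by (auto simp: pair_clusters_def)
  qed
  ultimately show ?thesis by (simp add: clusterings_def)
qed

lemma same_cluster_pair_clusters:
  assumes "T \<subseteq> vertex_pairs n" "e \<in> vertex_pairs n"
  shows "same_cluster (pair_clusters n T) e \<longleftrightarrow> e \<in> T"
proof -
  have e: "card e = 2" using assms(2) by (simp add: vertex_pairs_def)
  have "e = C" if "C \<in> T" "e \<subseteq> C" for C
  proof -
    have "card C = 2" using that assms(1) by (auto simp: vertex_pairs_def)
    then show ?thesis using e that(2) by (intro card_subset_eq) (auto intro: card_ge_0_finite)
  qed
  moreover have "\<not> e \<subseteq> {u}" for u
    using e card_mono[of "{u}" e] by auto
  ultimately show ?thesis
    by (auto simp: same_cluster_def pair_clusters_def)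
qed

text \<open>Expanding \<open>\<Prod>i. b i + c i\<close> according to the first index at which \<open>b\<close> is chosen.\<close>

lemma sum_first_choice_eq_prod:
  fixes b c :: "nat \<Rightarrow> ennreal"
  shows "(\<Sum>j<m. \<Prod>i<m. if i < j then c i else if i = j then b i else b i + c i)
    + (\<Prod>i<m. c i) = (\<Prod>i<m. b i + c i)"
proof (induction m)
  case (Suc m)
  let ?f = "\<lambda>j i. if i < j then c i else if i = j then b i else b i + c i"
  have "(\<Sum>j<Suc m. \<Prod>i<Suc m. ?f j i) + (\<Prod>i<Suc m. c i) =
      (\<Sum>j<m. (\<Prod>i<m. ?f j i) * (b m + c m)) + (\<Prod>i<m. c i) * b m + (\<Prod>i<m. c i) * c m"
    by simp
  also have "\<dots> = ((\<Sum>j<m. \<Prod>i<m. ?f j i) + (\<Prod>i<m. c i)) * (b m + c m)"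
    by (simp add: sum_distrib_right distrib_right distrib_left sum.distrib add.assoc)
  finally show ?case using Suc.IH by simp
qed simp

text \<open>Indexing the pairs allows one of them to be resampled with the others fixed, and gives a
  meaning to the first pair with a given property.\<close>

definition ordered_matchings :: "nat \<Rightarrow> nat \<Rightarrow> (nat \<Rightarrow> nat set) set" where
  "ordered_matchings n m = {z \<in> {..<m} \<rightarrow>\<^sub>E vertex_pairs n. disjoint_family_on z {..<m}}"

lemma finite_ordered_matchings: "finite (ordered_matchings n m)"
  unfolding ordered_matchings_def
  by (rule finite_subset[of _ "{..<m} \<rightarrow>\<^sub>E vertex_pairs n"]) (auto simp: finite_vertex_pairs intro!: finite_PiE)

lemma ordered_matchings_nonempty:
  assumes "2 * m \<le> n"
  shows "ordered_matchings n m \<noteq> {}"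
proof -
  have "restrict (\<lambda>i. {2 * i + 1, 2 * i + 2}) {..<m} \<in> ordered_matchings n m"
    using assms by (auto simp: ordered_matchings_def vertex_pairs_def disjoint_family_on_def)
  then show ?thesis by blast
qed

lemma ordered_matchings_imp:
  assumes "z \<in> ordered_matchings n m"
  shows "z ` {..<m} \<subseteq> vertex_pairs n" "inj_on z {..<m}" "disjoint (z ` {..<m})"
proof -
  have d: "disjoint_family_on z {..<m}" using assms by (simp add: ordered_matchings_def)
  have v: "z i \<in> vertex_pairs n" if "i < m" for i
    using assms that by (auto simp: ordered_matchings_def)
  show "z ` {..<m} \<subseteq> vertex_pairs n" using v by auto
  have ne: "z i \<noteq> {}" if "i < m" for i using v[OF that] by (auto simp: vertex_pairs_def)
  show "inj_on z {..<m}"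
  proof (rule inj_onI, rule ccontr)
    fix i i' assume i: "i \<in> {..<m}" "i' \<in> {..<m}" "z i = z i'" "i \<noteq> i'"
    then have "z i \<inter> z i' = {}" using d unfolding disjoint_family_on_def by blast
    with i ne show False by simp
  qed
  show "disjoint (z ` {..<m})"
    by (rule disjoint_family_on_disjoint_image[OF d])
qed

text \<open>The other pairs occupy \<open>2 * (m - 1)\<close> vertices, and any 2-subset of the rest
  may be the new pair. The count is the same for all \<open>z\<close>, as uniform resampling
  requires.\<close>

lemma card_ordered_matchings_upd:
  assumes z: "z \<in> ordered_matchings n m" and j: "j < m"
  shows "{x. z(j := x) \<in> ordered_matchings n m} =
      {x. x \<subseteq> {1..n} - \<Union>(z ` ({..<m} - {j})) \<and> card x = 2}" (is "?A = ?B")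
    and "card {x. z(j := x) \<in> ordered_matchings n m} = (n - 2 * (m - 1)) choose 2"
proof -
  have d: "disjoint_family_on z {..<m}" and v: "z \<in> {..<m} \<rightarrow>\<^sub>E vertex_pairs n"
    using z by (auto simp: ordered_matchings_def)
  have "z(j := x) \<in> ordered_matchings n m \<longleftrightarrow>
      x \<in> vertex_pairs n \<and> (\<forall>i\<in>{..<m} - {j}. x \<inter> z i = {})" for x
  proof -
    have "z(j := x) \<in> {..<m} \<rightarrow>\<^sub>E vertex_pairs n \<longleftrightarrow> x \<in> vertex_pairs n"
      using v j by (auto simp: PiE_def Pi_def extensional_def)
    moreover have "disjoint_family_on (z(j := x)) {..<m} \<longleftrightarrow> (\<forall>i\<in>{..<m} - {j}. x \<inter> z i = {})"
      using d j by (auto simp: disjoint_family_on_def Int_commute)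
    ultimately show ?thesis by (simp add: ordered_matchings_def)
  qed
  then show AB: "?A = ?B" by (auto simp: vertex_pairs_def)
  let ?I = "{..<m} - {j}"
  have U: "\<Union>(z ` ?I) \<subseteq> {1..n}" using v by (force simp: PiE_def Pi_def vertex_pairs_def)
  have two: "card (z i) = 2" if "i < m" for i
    using v that by (auto simp: PiE_def Pi_def vertex_pairs_def)
  have "card (\<Union>(z ` ?I)) = (\<Sum>i\<in>?I. card (z i))"
    using d two by (intro card_UN_disjoint) (auto simp: disjoint_family_on_def intro!: card_ge_0_finite)
  also have "\<dots> = 2 * (m - 1)" using two j by (simp add: card_Diff_singleton)
  finally have "card ({1..n} - \<Union>(z ` ?I)) = n - 2 * (m - 1)"
    using card_Diff_subset[OF finite_subset[OF U] U] by simp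
  then show "card ?A = (n - 2 * (m - 1)) choose 2"
    unfolding AB by (subst n_subsets) auto
qed

context weighted_pairs
begin

lemma likelihood_pair_clusters:
  assumes "T \<subseteq> vertex_pairs n"
  shows "likelihood n (pair_clusters n T) W = (\<Prod>e\<in>T. ennreal (l (W e)))"
proof -
  have "{e. e \<in> vertex_pairs n \<and> same_cluster (pair_clusters n T) e} = T"
    using assms same_cluster_pair_clusters[OF assms] by auto
  then show ?thesis by (simp add: likelihood_def)
qed

lemma nn_integral_base_prod_inj:
  assumes "inj_on z I" "z ` I \<subseteq> vertex_pairs n"
    and "\<And>i. i \<in> I \<Longrightarrow> g i \<in> borel_measurable borel"
  shows "(\<integral>\<^sup>+ W. (\<Prod>i\<in>I. g i (W (z i))) \<partial>base n) = (\<Prod>i\<in>I. \<integral>\<^sup>+ x. g i x \<partial>f_minus)"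
proof -
  have inv: "the_inv_into I z (z i) = i" if "i \<in> I" for i
    using assms(1) that by (rule the_inv_into_f_f)
  have "(\<integral>\<^sup>+ W. (\<Prod>e\<in>z ` I. g (the_inv_into I z e) (W e)) \<partial>base n) =
      (\<Prod>e\<in>z ` I. \<integral>\<^sup>+ x. g (the_inv_into I z e) x \<partial>f_minus)"
    using assms by (intro nn_integral_base_prod) (auto simp: inv)
  then show ?thesis
    by (simp add: prod.reindex[OF assms(1)] inv cong: prod.cong)
qed

lemma nn_integral_pair_base_snd:
  assumes "prob_space R" "f \<in> borel_measurable (base n)"
  shows "(\<integral>\<^sup>+ \<omega>. f (snd \<omega>) \<partial>(R \<Otimes>\<^sub>M base n)) = (\<integral>\<^sup>+ W. f W \<partial>base n)"
proof -
  interpret R: prob_space R by fact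
  interpret B: prob_space "base n" by (rule prob_space_base)
  have "(\<lambda>\<omega>. f (snd \<omega>)) \<in> borel_measurable (R \<Otimes>\<^sub>M base n)"
    by (rule measurable_compose[OF measurable_snd assms(2)])
  from B.nn_integral_fst[OF this] show ?thesis
    by (simp add: R.emeasure_space_1)
qed

text \<open>The hard inputs: a random matching of \<open>m\<close> pairs, all other clusters being singletons. The
  density \<open>l\<close> of a matched pair is at least \<open>\<delta>\<close> on a set \<open>S\<close>; splitting off the part
  \<open>\<delta> * indicator S\<close>, a matched pair looks like an unmatched one (conditioned on \<open>S\<close>) with
  probability \<open>\<delta> * measure f_minus S\<close>. The weight \<open>w z j\<close> describes the event that \<open>j\<close> is the first
  index where this happens.\<close>

lemma hidden_pair_bound:
  fixes p Q \<delta> :: real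
  defines "s \<equiv> measure f_minus {x. \<delta> \<le> l x}"
  assumes alg: "clustering_algorithm R A"
    and \<delta>: "0 < \<delta>" and s: "0 < s" and K: "0 < K" and mk: "m \<le> k"
    and p: "0 \<le> p" "\<And>P. P \<in> clusterings (k + m) k \<Longrightarrow>
      failure_prob f_plus f_minus R A (k + m) P \<le> p"
    and Q: "0 \<le> Q" "\<And>P. P \<in> clusterings (k + m) k \<Longrightarrow>
      expected_queries f_plus f_minus R A (k + m) P \<le> ennreal Q"
    and r: "r = (k + m - 2 * (m - 1)) choose 2"
  shows "real r * (1 - (1 - \<delta> * s) ^ m) \<le> real r * (p + Q / real K) + real (K + 1) / s"
proof -
  define n where "n = k + m"
  define S where "S = {x. \<delta> \<le> l x}"
  define l1 l2 :: "real \<Rightarrow> real" where "l1 x = \<delta> * indicator S x" and "l2 x = l x - l1 x" for x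
  define \<beta> where "\<beta> = \<delta> * s"
  \<comment> \<open>For \<open>j\<close> to be the first index, earlier pairs take the residual
    density \<open>l2\<close>, pair \<open>j\<close> takes \<open>l1\<close>, and later pairs are
    unrestricted.\<close>
  define h where "h j i = (if i < j then l2 else if i = j then l1 else l)" for i j :: nat
  define Z where "Z = ordered_matchings n m"
  define P where "P z = pair_clusters n (z ` {..<m})" for z :: "nat \<Rightarrow> nat set"
  define B where "B = R \<Otimes>\<^sub>M base n"
  define w where "w z j W = (\<Prod>i<m. ennreal (h j i (W (z i))))" for z j and W :: "nat set \<Rightarrow> real"
  \<comment> \<open>Without the factor at \<open>j\<close> that weight has law
    \<open>f_minus\<close>, as if the pair were unmatched; this is the weight of the
    reference.\<close>
  define w0 where "w0 z j W = (\<Prod>i\<in>{..<m} - {j}. ennreal (h j i (W (z i))))"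
    for z j and W :: "nat set \<Rightarrow> real"
  define F where "F j z = (\<integral>\<^sup>+ \<omega>. w z j (snd \<omega>) * of_bool (result (P z) (A n (fst \<omega>) (snd \<omega>)) \<noteq> P z) \<partial>B)" for j z
  define N where "N j z = (\<integral>\<^sup>+ \<omega>. w z j (snd \<omega>) * of_nat (num_queries (P z) (A n (fst \<omega>) (snd \<omega>))) \<partial>B)" for j z
  have R: "prob_space R" and qw: "\<And>\<omega>. queries_within n (A n (fst \<omega>) (snd \<omega>))"
    using alg by (auto simp: clustering_algorithm_def)
  have S_meas: "S \<in> sets borel" unfolding S_def by measurable
  have l1_meas: "l1 \<in> borel_measurable borel"
    unfolding l1_def using S_meas by measurable
  have l2_meas: "l2 \<in> borel_measurable borel"
    unfolding l2_def using l1_meas l_meas by measurable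
  have h_meas: "(\<lambda>x. ennreal (h j i x)) \<in> borel_measurable borel" for j i
    unfolding h_def using l1_meas l2_meas l_meas by (cases "i < j"; cases "i = j") auto
  have l1_nonneg: "0 \<le> l1 x" and l2_nonneg: "0 \<le> l2 x" and l1_le: "l1 x \<le> \<delta>" for x
    using \<delta> l_nonneg by (auto simp: l1_def l2_def S_def indicator_def)
  have l12: "ennreal (l1 x) + ennreal (l2 x) = ennreal (l x)" for x
  proof -
    have "l1 x + l2 x = l x" by (simp add: l2_def)
    then show ?thesis by (metis ennreal_plus l1_nonneg l2_nonneg)
  qed
  have to_minus: "f \<in> borel_measurable f_minus" if "f \<in> borel_measurable borel" for f :: "real \<Rightarrow> ennreal"
    using that by (simp add: sets_minus cong: measurable_cong_sets)
  have int1: "(\<integral>\<^sup>+ x. ennreal (l1 x) \<partial>f_minus) = ennreal \<beta>"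
  proof -
    have "(\<integral>\<^sup>+ x. ennreal (l1 x) \<partial>f_minus) = (\<integral>\<^sup>+ x. ennreal \<delta> * indicator S x \<partial>f_minus)"
      by (intro nn_integral_cong) (auto simp: l1_def indicator_def)
    also have "\<dots> = ennreal \<delta> * emeasure f_minus S"
      using S_meas by (intro nn_integral_cmult_indicator) (simp add: sets_minus)
    also have "\<dots> = ennreal \<beta>"
      using \<delta> by (simp add: minus.emeasure_eq_measure \<beta>_def s_def S_def ennreal_mult)
    finally show ?thesis .
  qed
  have "(\<integral>\<^sup>+ x. ennreal (l x) \<partial>f_minus) = (\<integral>\<^sup>+ x. ennreal (l1 x) + ennreal (l2 x) \<partial>f_minus)"
    by (simp add: l12)
  also have "\<dots> = ennreal \<beta> + (\<integral>\<^sup>+ x. ennreal (l2 x) \<partial>f_minus)"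
    unfolding int1[symmetric]
    using l1_meas l2_meas by (intro nn_integral_add to_minus) simp_all
  finally have sum1: "ennreal \<beta> + (\<integral>\<^sup>+ x. ennreal (l2 x) \<partial>f_minus) = 1"
    by (simp add: nn_integral_minus_l)
  have \<beta>0: "0 < \<beta>" using \<delta> s by (simp add: \<beta>_def)
  have "ennreal \<beta> \<le> 1" using sum1 by (metis le_iff_add)
  then have \<beta>1: "\<beta> \<le> 1" by simp
  have int2: "(\<integral>\<^sup>+ x. ennreal (l2 x) \<partial>f_minus) = ennreal (1 - \<beta>)"
  proof -
    have "ennreal \<beta> + (\<integral>\<^sup>+ x. ennreal (l2 x) \<partial>f_minus) = ennreal \<beta> + ennreal (1 - \<beta>)"
      using sum1 ennreal_plus[of \<beta> "1 - \<beta>"] \<beta>0 \<beta>1 by simp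
    then show ?thesis by (simp add: ennreal_add_left_cancel)
  qed
  have finZ: "finite Z" unfolding Z_def by (rule finite_ordered_matchings)
  have P_in: "P z \<in> clusterings n k" if "z \<in> Z" for z
    unfolding P_def using ordered_matchings_imp[OF that[unfolded Z_def]]
    by (intro pair_clusters_in_clusterings) (auto simp: n_def card_image)
  have w_meas: "(\<lambda>W. \<Prod>i\<in>I. ennreal (h j i (W (z i)))) \<in> borel_measurable (base n)"
    if "z \<in> Z" "I \<subseteq> {..<m}" for z I j
    using ordered_matchings_imp(1)[OF that(1)[unfolded Z_def]] that(2)
    by (intro borel_measurable_prod_ennreal measurable_compose[OF component_measurable h_meas]) auto
  have w_meas': "(\<lambda>\<omega>. w z j (snd \<omega>)) \<in> borel_measurable B"
    "(\<lambda>\<omega>. w0 z j (snd \<omega>)) \<in> borel_measurable B" if "z \<in> Z" for z j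
    unfolding w_def w0_def B_def
    by (intro measurable_compose[OF measurable_snd w_meas] that; auto)+
  have w_int: "(\<integral>\<^sup>+ \<omega>. (\<Prod>i\<in>I. ennreal (h j i (snd \<omega> (z i)))) \<partial>B) =
      (\<Prod>i\<in>I. \<integral>\<^sup>+ x. ennreal (h j i x) \<partial>f_minus)" if "z \<in> Z" "I \<subseteq> {..<m}" for z j I
  proof -
    note z = ordered_matchings_imp[OF that(1)[unfolded Z_def]]
    have "(\<integral>\<^sup>+ \<omega>. (\<Prod>i\<in>I. ennreal (h j i (snd \<omega> (z i)))) \<partial>B) =
      (\<integral>\<^sup>+ W. (\<Prod>i\<in>I. ennreal (h j i (W (z i)))) \<partial>base n)"
      unfolding B_def by (rule nn_integral_pair_base_snd[OF R w_meas[OF that]])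
    also have "\<dots> = (\<Prod>i\<in>I. \<integral>\<^sup>+ x. ennreal (h j i x) \<partial>f_minus)"
      using z that(2) h_meas by (intro nn_integral_base_prod_inj) (auto intro: inj_on_subset)
    finally show ?thesis .
  qed
  have w0_int: "(\<integral>\<^sup>+ \<omega>. w0 z j (snd \<omega>) \<partial>B) = ennreal ((1 - \<beta>) ^ j)" if "z \<in> Z" "j < m" for z j
  proof -
    have "(\<integral>\<^sup>+ \<omega>. w0 z j (snd \<omega>) \<partial>B) = (\<Prod>i\<in>{..<m} - {j}. \<integral>\<^sup>+ x. ennreal (h j i x) \<partial>f_minus)"
      unfolding w0_def by (rule w_int[OF that(1)]) auto
    also have "\<dots> = (\<Prod>i\<in>{..<m} - {j}. if i < j then ennreal (1 - \<beta>) else 1)"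
      by (intro prod.cong) (auto simp: h_def int2 nn_integral_minus_l)
    also have "\<dots> = (\<Prod>i\<in>{..<j}. ennreal (1 - \<beta>))"
      using that(2) by (intro prod.mono_neutral_cong_right) auto
    also have "\<dots> = ennreal ((1 - \<beta>) ^ j)"
      using \<beta>1 by (simp add: ennreal_power)
    finally show ?thesis .
  qed
  have w_w0: "w z j W = ennreal (l1 (W (z j))) * w0 z j W" if "j < m" for z j W
    unfolding w_def w0_def using that by (subst prod.remove[of _ j]) (auto simp: h_def)
  have w_int': "(\<integral>\<^sup>+ \<omega>. w z j (snd \<omega>) \<partial>B) = ennreal (\<beta> * (1 - \<beta>) ^ j)" if "z \<in> Z" "j < m" for z j
  proof -
    have "(\<integral>\<^sup>+ \<omega>. w z j (snd \<omega>) \<partial>B) = (\<Prod>i<m. \<integral>\<^sup>+ x. ennreal (h j i x) \<partial>f_minus)"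
      unfolding w_def by (rule w_int[OF that(1)]) auto
    also have "\<dots> = ennreal \<beta> * (\<Prod>i\<in>{..<m} - {j}. \<integral>\<^sup>+ x. ennreal (h j i x) \<partial>f_minus)"
      using that(2) by (subst prod.remove[of _ j]) (auto simp: h_def int1)
    also have "(\<Prod>i\<in>{..<m} - {j}. \<integral>\<^sup>+ x. ennreal (h j i x) \<partial>f_minus) = (\<integral>\<^sup>+ \<omega>. w0 z j (snd \<omega>) \<partial>B)"
      unfolding w0_def by (rule w_int[OF that(1), symmetric]) auto
    finally show ?thesis using \<beta>0 \<beta>1 by (simp add: w0_int[OF that] ennreal_mult)
  qed
  \<comment> \<open>The weights are distinct parts of the expanded likelihood; the part in which no
    index takes \<open>l1\<close> is discarded.\<close>
  have sum_w: "(\<Sum>j<m. w z j W) \<le> likelihood n (P z) W" if "z \<in> Z" for z W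
  proof -
    note z = ordered_matchings_imp[OF that[unfolded Z_def]]
    let ?b = "\<lambda>i. ennreal (l1 (W (z i)))" and ?c = "\<lambda>i. ennreal (l2 (W (z i)))"
    have "w z j W = (\<Prod>i<m. if i < j then ?c i else if i = j then ?b i else ?b i + ?c i)" for j
      unfolding w_def by (intro prod.cong) (auto simp: h_def l12)
    then have "(\<Sum>j<m. w z j W) + (\<Prod>i<m. ?c i) = (\<Prod>i<m. ?b i + ?c i)"
      using sum_first_choice_eq_prod[of ?c ?b m] by simp
    also have "\<dots> = likelihood n (P z) W"
      unfolding P_def likelihood_pair_clusters[OF z(1)] by (simp add: l12 prod.reindex[OF z(2)])
    finally show ?thesis by (metis le_iff_add)
  qed
  have upd_card: "card {x. z(j := x) \<in> Z} = r" if "z \<in> Z" "j < m" for z j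
    using card_ordered_matchings_upd(2)[OF that[unfolded Z_def]] unfolding Z_def r n_def .
  have upd_fin: "finite {x. z(j := x) \<in> Z}" if "z \<in> Z" "j < m" for z j
    unfolding Z_def card_ordered_matchings_upd(1)[OF that[unfolded Z_def]]
    by (rule finite_subset[of _ "Pow {1..n}"]) auto
  \<comment> \<open>Only pair \<open>j\<close> varies. The reference joins just the other
    \<open>m - 1\<close> pairs, so the query \<open>x\<close> alone separates it from the
    alternative \<open>x\<close>.\<close>
  have one: "of_nat r * ennreal (\<beta> * (1 - \<beta>) ^ j) \<le>
      (\<Sum>x | z(j := x) \<in> Z. F j (z(j := x)) + N j (z(j := x)) / of_nat K)
      + ennreal (\<delta> * (real (K + 1) * (1 - \<beta>) ^ j))" if z: "z \<in> Z" and j: "j < m" for z j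
  proof -
    define X where "X = {x. z(j := x) \<in> Z}"
    define T where "T = z ` ({..<m} - {j})"
    have T: "T \<subseteq> vertex_pairs n"
      using ordered_matchings_imp(1)[OF z[unfolded Z_def]] by (auto simp: T_def)
    have upd_img: "(z(j := x)) ` {..<m} = insert x T" for x
      using j by (auto simp: T_def image_iff)
    have X_pairs: "x \<in> vertex_pairs n" "x \<notin> T" if "x \<in> X" for x
    proof -
      have zx: "z(j := x) \<in> ordered_matchings n m" using that by (simp add: X_def Z_def)
      note i = ordered_matchings_imp[OF zx]
      show "x \<in> vertex_pairs n" using i(1) unfolding upd_img by simp
      have "z i \<noteq> x" if "i \<in> {..<m} - {j}" for i
      proof
        assume "z i = x"
        then have "(z(j := x)) i = (z(j := x)) j" using that by simp
        with inj_onD[OF i(2) this] that j show False by simp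
      qed
      then show "x \<notin> T" by (auto simp: T_def)
    qed
    have "(\<Sum>x\<in>X. \<integral>\<^sup>+ \<omega>. w (z(j := x)) j (snd \<omega>) \<partial>B)
      \<le> (\<Sum>x\<in>X. (\<integral>\<^sup>+ \<omega>. w (z(j := x)) j (snd \<omega>) *
            of_bool (result (P (z(j := x))) (A n (fst \<omega>) (snd \<omega>)) \<noteq> P (z(j := x))) \<partial>B)
          + (\<integral>\<^sup>+ \<omega>. w (z(j := x)) j (snd \<omega>) *
            of_nat (queries_in (\<Union>x\<in>X. {x}) (P (z(j := x))) (A n (fst \<omega>) (snd \<omega>))) \<partial>B) / of_nat K)
        + (\<Sum>x\<in>X. 0)
        + ennreal \<delta> * (of_nat (K + 1) * (\<integral>\<^sup>+ \<omega>. w0 z j (snd \<omega>) \<partial>B))"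
    proof (rule sum_weight_le_failure)
      show "(\<lambda>\<omega>. A n (fst \<omega>) (snd \<omega>)) \<in> B \<rightarrow>\<^sub>M count_space UNIV"
        unfolding B_def by (rule algorithm_measurable[OF alg])
      show "disjoint_family_on (\<lambda>x. {x}) X" by (auto simp: disjoint_family_on_def)
      show "same_cluster (P (z(j := x))) e \<longleftrightarrow> same_cluster (pair_clusters n T) e \<or> e \<in> {x}"
        if "x \<in> X" "e \<in> vertex_pairs n" for x e
        using same_cluster_pair_clusters[of "insert x T" n e] same_cluster_pair_clusters[of T n e]
          T X_pairs[OF that(1)] that(2)
        unfolding P_def upd_img by auto
      show "\<exists>e\<in>{x}. e \<in> vertex_pairs n \<and> \<not> same_cluster (pair_clusters n T) e" if "x \<in> X" for x
        using same_cluster_pair_clusters[OF T] X_pairs[OF that] by auto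
      show "finite X" unfolding X_def by (rule upd_fin[OF z j])
      show "(\<lambda>\<omega>. w (z(j := x)) j (snd \<omega>)) \<in> borel_measurable B" if "x \<in> X" for x
        using that by (intro w_meas') (simp add: X_def)
      show "(\<lambda>\<omega>. w0 z j (snd \<omega>)) \<in> borel_measurable B" by (rule w_meas'[OF z])
      show "(\<integral>\<^sup>+ \<omega>. w (z(j := x)) j (snd \<omega>) * indicator Y \<omega> \<partial>B) \<le> 0 +
        ennreal \<delta> * (\<integral>\<^sup>+ \<omega>. w0 z j (snd \<omega>) * indicator Y \<omega> \<partial>B)" if "Y \<in> sets B" for x Y
      proof -
        have "w0 (z(j := x)) j W = w0 z j W" for W
          unfolding w0_def by (intro prod.cong) auto
        \<comment> \<open>As \<open>l1\<close> is at most \<delta>, each alternative is dominated by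
          \<delta> times the reference without an additive error.\<close>
        then have le: "w (z(j := x)) j W \<le> ennreal \<delta> * w0 z j W" for W
          unfolding w_w0[OF j] by (auto intro!: mult_right_mono ennreal_leI l1_le)
        have "(\<integral>\<^sup>+ \<omega>. w (z(j := x)) j (snd \<omega>) * indicator Y \<omega> \<partial>B) \<le>
            (\<integral>\<^sup>+ \<omega>. ennreal \<delta> * (w0 z j (snd \<omega>) * indicator Y \<omega>) \<partial>B)"
          by (intro nn_integral_mono) (auto simp: mult.assoc[symmetric] intro!: mult_right_mono le)
        also have "\<dots> = ennreal \<delta> * (\<integral>\<^sup>+ \<omega>. w0 z j (snd \<omega>) * indicator Y \<omega> \<partial>B)"
          using w_meas'(2)[OF z] that by (intro nn_integral_cmult) auto
        finally show ?thesis by simp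
      qed
    qed (use qw K in auto)
    also have "(\<Sum>x\<in>X. \<integral>\<^sup>+ \<omega>. w (z(j := x)) j (snd \<omega>) \<partial>B) = (\<Sum>x\<in>X. ennreal (\<beta> * (1 - \<beta>) ^ j))"
      by (intro sum.cong refl w_int') (use j in \<open>auto simp: X_def\<close>)
    also have "\<dots> = of_nat r * ennreal (\<beta> * (1 - \<beta>) ^ j)"
      by (simp add: X_def upd_card[OF z j])
    also have "(\<integral>\<^sup>+ \<omega>. w0 z j (snd \<omega>) \<partial>B) = ennreal ((1 - \<beta>) ^ j)"
      by (rule w0_int[OF z j])
    also have "ennreal \<delta> * (of_nat (K + 1) * ennreal ((1 - \<beta>) ^ j)) =
        ennreal (\<delta> * (real (K + 1) * (1 - \<beta>) ^ j))"
      using \<delta> \<beta>1 by (simp add: ennreal_mult ennreal_of_nat_eq_real_of_nat)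
    finally have "of_nat r * ennreal (\<beta> * (1 - \<beta>) ^ j) \<le>
      (\<Sum>x\<in>X. (\<integral>\<^sup>+ \<omega>. w (z(j := x)) j (snd \<omega>) *
            of_bool (result (P (z(j := x))) (A n (fst \<omega>) (snd \<omega>)) \<noteq> P (z(j := x))) \<partial>B)
          + (\<integral>\<^sup>+ \<omega>. w (z(j := x)) j (snd \<omega>) *
            of_nat (queries_in (\<Union>x\<in>X. {x}) (P (z(j := x))) (A n (fst \<omega>) (snd \<omega>))) \<partial>B) / of_nat K)
        + ennreal (\<delta> * (real (K + 1) * (1 - \<beta>) ^ j))"
      by (simp only: sum.neutral_const add_0_right)
    also have "\<dots> \<le> (\<Sum>x\<in>X. F j (z(j := x)) + N j (z(j := x)) / of_nat K)
        + ennreal (\<delta> * (real (K + 1) * (1 - \<beta>) ^ j))"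
      unfolding F_def N_def
      by (intro add_mono sum_mono order_refl divide_right_mono_ennreal nn_integral_mono
          mult_left_mono of_nat_mono queries_in_le_num_queries) auto
    finally show ?thesis unfolding X_def .
  qed
  \<comment> \<open>The product \<open>\<beta> * G\<close> is the total mass of the weights, which
    is the probability that at least one of the \<open>m\<close> pairs takes
    \<open>l1\<close>.\<close>
  define G where "G = (\<Sum>j<m. (1 - \<beta>) ^ j)"
  have G: "\<beta> * G = 1 - (1 - \<beta>) ^ m" "0 \<le> G"
    using \<beta>1 one_diff_power_eq[of "1 - \<beta>" m] by (auto simp: G_def intro!: sum_nonneg)
  have "(\<Sum>j<m. \<Sum>z\<in>Z. of_nat r * ennreal (\<beta> * (1 - \<beta>) ^ j)) \<le>
      (\<Sum>j<m. \<Sum>z\<in>Z. (\<Sum>x | z(j := x) \<in> Z. F j (z(j := x)) + N j (z(j := x)) / of_nat K)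
        + ennreal (\<delta> * (real (K + 1) * (1 - \<beta>) ^ j)))"
    by (intro sum_mono one) auto
  also have "\<dots> = (\<Sum>j<m. \<Sum>z\<in>Z. of_nat r * (F j z + N j z / of_nat K)) +
      (\<Sum>j<m. \<Sum>z\<in>Z. ennreal (\<delta> * (real (K + 1) * (1 - \<beta>) ^ j)))"
  proof -
    have "(\<Sum>z\<in>Z. \<Sum>x | z(j := x) \<in> Z. F j (z(j := x)) + N j (z(j := x)) / of_nat K) =
        (\<Sum>z\<in>Z. of_nat r * (F j z + N j z / of_nat K))" if "j < m" for j
      using sum_resample_coordinate[OF finZ upd_fin[OF _ that], of "\<lambda>z. F j z + N j z / of_nat K"]
        upd_card[OF _ that] by simp
    then show ?thesis by (simp add: sum.distrib)
  qed
  also have "(\<Sum>j<m. \<Sum>z\<in>Z. of_nat r * (F j z + N j z / of_nat K)) =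
      (\<Sum>z\<in>Z. of_nat r * (\<Sum>j<m. F j z + N j z / of_nat K))"
    by (subst sum.swap) (simp add: sum_distrib_left)
  also have "\<dots> \<le> (\<Sum>z\<in>Z. of_nat r * ennreal (p + Q / real K))"
  proof (intro sum_mono mult_left_mono)
    fix z assume z: "z \<in> Z"
    \<comment> \<open>Since the weights add up to at most the likelihood, failure and queries summed
      over \<open>j\<close> are bounded by their values under the true law.\<close>
    have sum_le: "(\<Sum>j<m. \<integral>\<^sup>+ \<omega>. w z j (snd \<omega>) * H (A n (fst \<omega>) (snd \<omega>)) \<partial>B) \<le>
        (\<integral>\<^sup>+ \<omega>. likelihood n (P z) (snd \<omega>) * H (A n (fst \<omega>) (snd \<omega>)) \<partial>B)" for H :: "dtree \<Rightarrow> ennreal"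
    proof -
      have "(\<Sum>j<m. \<integral>\<^sup>+ \<omega>. w z j (snd \<omega>) * H (A n (fst \<omega>) (snd \<omega>)) \<partial>B) =
          (\<integral>\<^sup>+ \<omega>. (\<Sum>j<m. w z j (snd \<omega>) * H (A n (fst \<omega>) (snd \<omega>))) \<partial>B)"
        using w_meas'(1)[OF z] algorithm_compose_measurable[OF alg, of H n, folded B_def]
        by (intro nn_integral_sum[symmetric] borel_measurable_times_ennreal) auto
      also have "\<dots> \<le> (\<integral>\<^sup>+ \<omega>. likelihood n (P z) (snd \<omega>) * H (A n (fst \<omega>) (snd \<omega>)) \<partial>B)"
        by (intro nn_integral_mono) (auto simp: sum_distrib_right[symmetric] intro!: mult_right_mono sum_w z)
      finally show ?thesis .
    qed
    have "(\<Sum>j<m. F j z) \<le> ennreal (failure_prob f_plus f_minus R A n (P z))"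
      unfolding F_def failure_prob_eq[OF alg] B_def[symmetric]
      by (rule sum_le[of "\<lambda>t. of_bool (result (P z) t \<noteq> P z)"])
    also have "\<dots> \<le> ennreal p"
      using p(2) P_in[OF z] by (intro ennreal_leI) (simp add: n_def)
    finally have sF: "(\<Sum>j<m. F j z) \<le> ennreal p" .
    have "(\<Sum>j<m. N j z) \<le> expected_queries f_plus f_minus R A n (P z)"
      unfolding N_def expected_queries_eq[OF alg] B_def[symmetric]
      by (rule sum_le[of "\<lambda>t. of_nat (num_queries (P z) t)"])
    also have "\<dots> \<le> ennreal Q"
      using Q(2) P_in[OF z] by (simp add: n_def)
    finally have sN: "(\<Sum>j<m. N j z) \<le> ennreal Q" .
    have "(\<Sum>j<m. F j z + N j z / of_nat K) = (\<Sum>j<m. F j z) + (\<Sum>j<m. N j z) / of_nat K"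
      by (simp add: sum.distrib divide_ennreal_def sum_distrib_right)
    also have "\<dots> \<le> ennreal p + ennreal Q / of_nat K"
      by (intro add_mono divide_right_mono_ennreal sF sN)
    also have "ennreal Q / of_nat K = ennreal (Q / real K)"
      unfolding ennreal_of_nat_eq_real_of_nat using Q(1) K by (intro divide_ennreal) auto
    also have "ennreal p + ennreal (Q / real K) = ennreal (p + Q / real K)"
      using p(1) Q(1) by (simp add: ennreal_plus)
    finally show "(\<Sum>j<m. F j z + N j z / of_nat K) \<le> ennreal (p + Q / real K)" .
  qed simp
  finally have "(\<Sum>j<m. \<Sum>z\<in>Z. of_nat r * ennreal (\<beta> * (1 - \<beta>) ^ j)) \<le>
      (\<Sum>z\<in>Z. of_nat r * ennreal (p + Q / real K)) +
      (\<Sum>j<m. \<Sum>z\<in>Z. ennreal (\<delta> * (real (K + 1) * (1 - \<beta>) ^ j)))"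
    by (simp add: add_right_mono)
  moreover have "(\<Sum>j<m. \<Sum>z\<in>Z. of_nat r * ennreal (\<beta> * (1 - \<beta>) ^ j)) =
      ennreal (real (card Z) * (real r * (\<beta> * G)))"
  proof -
    have "(\<Sum>j<m. \<Sum>z\<in>Z. of_nat r * ennreal (\<beta> * (1 - \<beta>) ^ j)) =
        (\<Sum>j<m. ennreal (real (card Z) * (real r * (\<beta> * (1 - \<beta>) ^ j))))"
      using \<beta>0 \<beta>1 by (intro sum.cong) (simp_all add: ennreal_of_nat_eq_real_of_nat ennreal_mult)
    also have "\<dots> = ennreal (\<Sum>j<m. real (card Z) * (real r * (\<beta> * (1 - \<beta>) ^ j)))"
      using \<beta>0 \<beta>1 by (intro sum_ennreal) simp
    finally show ?thesis by (simp add: G_def sum_distrib_left)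
  qed
  moreover have "(\<Sum>j<m. \<Sum>z\<in>Z. ennreal (\<delta> * (real (K + 1) * (1 - \<beta>) ^ j))) =
      ennreal (real (card Z) * (\<delta> * (real (K + 1) * G)))"
  proof -
    have "(\<Sum>j<m. \<Sum>z\<in>Z. ennreal (\<delta> * (real (K + 1) * (1 - \<beta>) ^ j))) =
        (\<Sum>j<m. ennreal (real (card Z) * (\<delta> * (real (K + 1) * (1 - \<beta>) ^ j))))"
      using \<delta> \<beta>1 by (intro sum.cong) (simp_all add: ennreal_of_nat_eq_real_of_nat ennreal_mult)
    also have "\<dots> = ennreal (\<Sum>j<m. real (card Z) * (\<delta> * (real (K + 1) * (1 - \<beta>) ^ j)))"
      using \<delta> \<beta>1 by (intro sum_ennreal) simp
    finally show ?thesis by (simp add: G_def sum_distrib_left)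
  qed
  moreover have "(\<Sum>z\<in>Z. of_nat r * ennreal (p + Q / real K)) =
      ennreal (real (card Z) * (real r * (p + Q / real K)))"
    using p(1) Q(1) by (simp add: ennreal_of_nat_eq_real_of_nat ennreal_mult)
  ultimately have "ennreal (real (card Z) * (real r * (\<beta> * G))) \<le>
      ennreal (real (card Z) * (real r * (p + Q / real K)) + real (card Z) * (\<delta> * (real (K + 1) * G)))"
    using p(1) Q(1) \<delta> G(2) by (subst ennreal_plus) auto
  then have "real (card Z) * (real r * (\<beta> * G)) \<le>
      real (card Z) * (real r * (p + Q / real K)) + real (card Z) * (\<delta> * (real (K + 1) * G))"
    using p(1) Q(1) \<delta> G(2) by (subst (asm) ennreal_le_iff) auto
  then have "real (card Z) * (real r * (\<beta> * G)) \<le>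
      real (card Z) * (real r * (p + Q / real K) + \<delta> * (real (K + 1) * G))"
    by (simp add: distrib_left)
  moreover have "0 < card Z"
    using ordered_matchings_nonempty[of m n] mk finZ by (simp add: Z_def n_def card_gt_0_iff)
  ultimately have main: "real r * (\<beta> * G) \<le> real r * (p + Q / real K) + \<delta> * (real (K + 1) * G)"
    by simp
  \<comment> \<open>Since \<open>\<beta> = \<delta> * s\<close>, this bounds
    \<open>\<delta> * G\<close> by \<open>1 / s\<close> and removes the small number \<delta> from
    the reference term.\<close>
  have "\<beta> * G \<le> 1" unfolding G(1) using \<beta>1 by simp
  then have "\<delta> * G \<le> 1 / s" using s by (simp add: \<beta>_def field_simps)
  then have "\<delta> * G * real (K + 1) \<le> 1 / s * real (K + 1)"
    by (intro mult_right_mono) auto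
  with main show ?thesis
    unfolding G(1) by (simp add: \<beta>_def mult_ac)
qed

end

section \<open>The lower bound\<close>

text \<open>The set where \<open>l\<close> is below \<open>exp (- t)\<close> has
  \<open>f_plus\<close>-mass at most \<open>exp (- t)\<close>, so in
  \<open>measure_le_divergence\<close> with parameter \<open>t\<close> the last term is at most 1. A
  bound on D(f_minus || f_plus) thus keeps \<open>l\<close> from being small on most of
  \<open>f_minus\<close>.\<close>

lemma (in weighted_pairs) measure_small_ratio_le:
  fixes q :: "real \<Rightarrow> real"
  assumes q: "q \<in> borel_measurable borel" "\<And>x. 0 \<le> q x" "f_minus = density f_plus q"
    and int: "integrable f_minus (\<lambda>x. ln (q x))" and d: "(\<integral>x. ln (q x) \<partial>f_minus) \<le> d"
  shows "t * measure f_minus {x. l x < exp (- t)} \<le> d + 1"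
proof -
  define X where "X = {x. l x < exp (- t)}"
  have X: "X \<in> sets borel" unfolding X_def by measurable
  have "emeasure f_plus X = (\<integral>\<^sup>+ x. ennreal (l x) * indicator X x \<partial>f_minus)"
    unfolding plus_eq using X l_meas
    by (intro emeasure_density) (simp_all add: sets_minus cong: measurable_cong_sets)
  also have "\<dots> \<le> (\<integral>\<^sup>+ x. ennreal (exp (- t)) \<partial>f_minus)"
    by (intro nn_integral_mono) (auto simp: X_def indicator_def intro: ennreal_leI)
  also have "\<dots> = ennreal (exp (- t))"
    by (simp add: minus.emeasure_space_1)
  finally have "measure f_plus X \<le> exp (- t)"
    by (simp add: plus.emeasure_eq_measure)
  then have "exp t * measure f_plus X \<le> exp t * exp (- t)"
    by (intro mult_left_mono) auto
  then have small: "exp t * measure f_plus X \<le> 1"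
    by (simp add: exp_minus)
  have "t * measure (density f_plus q) X \<le>
      (\<integral>x. ln (q x) \<partial>density f_plus q) + (exp t - 1) * measure f_plus X"
  proof (rule measure_le_divergence)
    show "prob_space (density f_plus q)" using prob_minus q(3) by simp
    show "q \<in> borel_measurable f_plus" "(\<lambda>x. ln (q x)) \<in> borel_measurable f_plus" "X \<in> sets f_plus"
      using q(1) X by (simp_all add: sets_plus cong: measurable_cong_sets)
    show "integrable (density f_plus q) (\<lambda>x. ln (q x))" using int q(3) by simp
  qed (use q prob_plus in auto)
  then have "t * measure f_minus X \<le> d + (exp t - 1) * measure f_plus X"
    using d q(3) by simp
  also have "\<dots> \<le> d + exp t * measure f_plus X"
    by (simp add: left_diff_distrib)
  finally show ?thesis using small by (simp add: X_def)
qed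

section \<open>Choice of constants\<close>

lemma real_choose_two: "real (n choose 2) = real n * (real n - 1) / 2"
proof -
  have "even (n * (n - 1))" by (cases n) auto
  then have "real (n choose 2) = real (n * (n - 1)) / 2"
    by (simp add: choose_two real_of_nat_div)
  then show ?thesis by (cases n) (auto simp: algebra_simps)
qed

text \<open>In units of \<open>m * k\<close> the left side is at most 0.1 for failure, 0.08 for
  queries, and 0.402 for divergence and elimination together. The size of \<open>m\<close> is
  limited by \<open>m * d \<le> k / 10\<close>.\<close>

lemma random_assignment_numeric:
  fixes k K m :: nat and d Q :: real
  assumes k: "1000 \<le> k" and d: "0 < d" "d \<le> 1 / 10"
    and K: "K = k div 10" and m: "m = nat \<lfloor>real k / (10 * d)\<rfloor>"
    and Q: "Q = real k ^ 2 / (10000 * d)"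
  shows "real k * (real m * (1 / 10) + 2 * Q / real K)
    + real m * (real (k + m) * d + (exp 1 - 1) * real (K + 1)) < real m * real k"
proof -
  have "real k \<le> real k / (10 * d)"
    using d mult_left_mono[of "10 * d" 1 "real k"] by (simp add: field_simps)
  then have kd: "1000 \<le> real k / (10 * d)" using k by linarith
  then have m1: "real m \<le> real k / (10 * d)" "real k / (10 * d) - 1 \<le> real m"
    unfolding m by linarith+
  have md: "real m * d \<le> real k / 10"
    using m1(1) d by (simp add: field_simps)
  \<comment> \<open>The floor loses at most 1, which is less than half of
    \<open>k / (10 * d)\<close>.\<close>
  have m2: "real k / (20 * d) \<le> real m"
    using m1(2) kd by simp
  have K1: "real K \<le> real k / 10" "real k / 20 \<le> real K" "0 < real K"
    using k unfolding K by linarith+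
  have "(exp 1 - 1) * real (K + 1) \<le> 2 * real (K + 1)"
    using exp_le by (intro mult_right_mono) auto
  \<comment> \<open>The excess 2 over \<open>k / 5\<close> is absorbed by
    \<open>2 * k / 1000\<close>, where \<open>1000 \<le> k\<close> enters.\<close>
  also have "\<dots> \<le> real k * (202 / 1000)"
    using K1(1) k by simp
  finally have e: "(exp 1 - 1) * real (K + 1) \<le> real k * (202 / 1000)" .
  have "real (k + m) * d = real k * d + real m * d" by (simp add: distrib_right)
  also have "\<dots> \<le> real k * (1 / 10) + real k / 10"
    using md d by (intro add_mono mult_left_mono) auto
  finally have "real (k + m) * d + (exp 1 - 1) * real (K + 1) \<le> real k * (402 / 1000)"
    using e by simp
  then have a: "real m * (real (k + m) * d + (exp 1 - 1) * real (K + 1)) \<le> real m * (real k * (402 / 1000))"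
    by (intro mult_left_mono) auto
  have "2 * Q / real K \<le> 2 * Q / (real k / 20)"
    using K1 k d by (intro divide_left_mono) (auto simp: Q)
  also have "\<dots> = real k / (20 * d) * (8 / 100)"
    using k d by (simp add: Q field_simps power2_eq_square)
  also have "\<dots> \<le> real m * (8 / 100)"
    using m2 by (intro mult_right_mono) auto
  finally have "real k * (2 * Q / real K) \<le> real k * (real m * (8 / 100))"
    by (intro mult_left_mono) auto
  moreover have "0 < real k * real m"
  proof (intro mult_pos_pos)
    have "0 < real k / (20 * d)" using k d by simp
    then show "0 < real m" using m2 by linarith
  qed (use k in simp)
  moreover have "real k * (real m * (1 / 10) + 2 * Q / real K) =
      real k * real m * (1 / 10) + real k * (2 * Q / real K)"
    by (simp only: distrib_left mult.assoc)
  moreover have "real m * (real k * (402 / 1000)) = real k * real m * (402 / 1000)"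
    "real k * (real m * (8 / 100)) = real k * real m * (8 / 100)" "real m * real k = real k * real m"
    by simp_all
  ultimately show ?thesis
    using a by linarith
qed

text \<open>In units of \<open>r\<close> the left side is at most 0.1 for failure and 0.32 for
  queries, and less than 0.48 for elimination. The total stays below 0.9, which the choice of
  \<open>m\<close> guarantees on the right.\<close>

lemma hidden_pair_numeric:
  fixes k K m r :: nat and d Q s \<delta> :: real
  assumes k: "1000 \<le> k" "2 * m \<le> k" and d: "1 / 10 < d"
    and K: "K = k\<^sup>2 div 160" and r: "r = (k + m - 2 * (m - 1)) choose 2"
    and Q: "Q = real k ^ 2 / (10000 * d)"
    and s: "3 / 4 \<le> s" "s \<le> 1" and \<delta>: "0 < \<delta>" "\<delta> \<le> 1" "(1 - 3 / 4 * \<delta>) ^ m \<le> 1 / 10"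
  shows "real r * (1 / 10 + Q / real K) + real (K + 1) / s < real r * (1 - (1 - \<delta> * s) ^ m)"
proof -
  have kk: "1000000 \<le> (real k)\<^sup>2"
    using power_mono[of 1000 "real k" 2] k by simp
  have "real (k\<^sup>2 div 160) \<le> real (k\<^sup>2) / 160" "real (k\<^sup>2) / 160 - 1 \<le> real (k\<^sup>2 div 160)"
    by linarith+
  then have K1: "real K \<le> (real k)\<^sup>2 / 160" "(real k)\<^sup>2 / 320 \<le> real K"
    using kk unfolding K by auto
  define u where "u = k + m - 2 * (m - 1)"
  \<comment> \<open>As \<open>2 * m \<le> k\<close>, about half of the vertices remain free for the
    resampled pair, so \<open>r\<close> is of order \<open>k\<^sup>2\<close>.\<close>
  have u: "real k / 2 + 1 \<le> real u" using k unfolding u_def by linarith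
  have "(real k / 2) * (real k / 2) \<le> real u * (real u - 1)"
    using u k by (intro mult_mono) auto
  then have r1: "(real k)\<^sup>2 / 8 \<le> real r"
    unfolding r u_def[symmetric] real_choose_two by (simp add: power2_eq_square)
  have "Q \<le> (real k)\<^sup>2 / 1000"
    unfolding Q using d kk by (intro divide_left_mono) auto
  then have "Q / real K \<le> ((real k)\<^sup>2 / 1000) / ((real k)\<^sup>2 / 320)"
    using K1 kk k by (intro frac_le) auto
  also have "\<dots> = 32 / 100" using k by (simp add: field_simps)
  finally have "real r * (1 / 10 + Q / real K) \<le> real r * (42 / 100)"
    by (intro mult_left_mono) linarith+
  moreover have "real (K + 1) / s \<le> real (K + 1) / (3 / 4)"
    using s by (intro divide_left_mono) auto
  moreover have "real (K + 1) / (3 / 4) < real r * (48 / 100)"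
    using K1(1) r1 kk by simp
  \<comment> \<open>Replacing \<open>s\<close> by its lower bound 3/4 can only increase the
    power.\<close>
  moreover have "real r * (9 / 10) \<le> real r * (1 - (1 - \<delta> * s) ^ m)"
  proof (intro mult_left_mono)
    have "\<delta> * (3 / 4) \<le> \<delta> * s" "\<delta> * s \<le> 1 * 1"
      using \<delta> s by (intro mult_left_mono mult_mono; simp)+
    then have "(1 - \<delta> * s) ^ m \<le> (1 - 3 / 4 * \<delta>) ^ m"
      by (intro power_mono) auto
    then show "9 / 10 \<le> 1 - (1 - \<delta> * s) ^ m" using \<delta>(3) by simp
  qed simp
  ultimately show ?thesis by linarith
qed

section \<open>Combination of the two regimes of the divergence\<close>

theorem theorem1:
  shows "\<exists>c::real. c > 0 \<and> (\<forall>B::real. \<exists>k0::nat. \<forall>k\<ge>k0. \<forall>f_plus f_minus :: real measure.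
    distribution_on_unit f_plus \<and> distribution_on_unit f_minus \<and>
    0 < sym_KL f_plus f_minus \<and> sym_KL f_plus f_minus \<le> ennreal B \<longrightarrow>
    (\<forall>R A. clustering_algorithm R A \<and>
       (\<forall>n. \<forall>P\<in>clusterings n k.
          expected_queries f_plus f_minus R A n P
            < ennreal (c * (real k)\<^sup>2) / sym_KL f_plus f_minus) \<longrightarrow>
       (\<exists>n. \<exists>P\<in>clusterings n k. failure_prob f_plus f_minus R A n P \<ge> 1 / 10)))"
proof (intro exI[of _ "1 / 10000 :: real"] conjI allI)
  fix B :: real
  \<comment> \<open>As \<open>4 * (d + 1) \<le> t\<close> for all \<open>d \<le> B\<close>, at most
    a quarter of \<open>f_minus\<close> lies where \<open>l\<close> is below \<delta>. Both \<delta>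
    and \<open>m\<close> depend on \<open>B\<close> alone and affect only the threshold
    \<open>k0\<close>.\<close>
  define t where "t = 4 * \<bar>B\<bar> + 4"
  define \<delta> where "\<delta> = exp (- t)"
  have t: "0 < t" "4 * (B + 1) \<le> t" by (auto simp: t_def)
  have \<delta>: "0 < \<delta>" "\<delta> \<le> 1" using t by (auto simp: \<delta>_def)
  obtain m where m: "(1 - 3 / 4 * \<delta>) ^ m < 1 / 10"
    using real_arch_pow_inv[of "1 / 10" "1 - 3 / 4 * \<delta>"] \<delta> by auto
  show "\<exists>k0. \<forall>k\<ge>k0. \<forall>f_plus f_minus :: real measure.
    distribution_on_unit f_plus \<and> distribution_on_unit f_minus \<and>
    0 < sym_KL f_plus f_minus \<and> sym_KL f_plus f_minus \<le> ennreal B \<longrightarrow>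
    (\<forall>R A. clustering_algorithm R A \<and>
       (\<forall>n. \<forall>P\<in>clusterings n k.
          expected_queries f_plus f_minus R A n P
            < ennreal (1 / 10000 * (real k)\<^sup>2) / sym_KL f_plus f_minus) \<longrightarrow>
       (\<exists>n. \<exists>P\<in>clusterings n k. failure_prob f_plus f_minus R A n P \<ge> 1 / 10))"
  proof (rule exI[of _ "max 1000 (2 * m)"], intro allI impI)
    fix k f_plus f_minus R A
    assume "max 1000 (2 * m) \<le> k"
    then have k: "1000 \<le> k" "2 * m \<le> k" by auto
    assume "distribution_on_unit f_plus \<and> distribution_on_unit f_minus \<and>
      0 < sym_KL f_plus f_minus \<and> sym_KL f_plus f_minus \<le> ennreal B"
    then have dist: "distribution_on_unit f_plus" "distribution_on_unit f_minus"
      and pos: "0 < sym_KL f_plus f_minus" and leB: "sym_KL f_plus f_minus \<le> ennreal B" by auto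
    assume "clustering_algorithm R A \<and> (\<forall>n. \<forall>P\<in>clusterings n k.
      expected_queries f_plus f_minus R A n P
        < ennreal (1 / 10000 * (real k)\<^sup>2) / sym_KL f_plus f_minus)"
    then have alg: "clustering_algorithm R A" and few: "\<And>n P. P \<in> clusterings n k \<Longrightarrow>
      expected_queries f_plus f_minus R A n P
        < ennreal (1 / 10000 * (real k)\<^sup>2) / sym_KL f_plus f_minus" by auto
    obtain d where d: "sym_KL f_plus f_minus = ennreal d" "0 < d" "d \<le> B"
    proof -
      \<comment> \<open>A nonpositive \<open>B\<close> would give \<open>ennreal B = 0\<close>,
        contrary to \<open>pos\<close>.\<close>
      have B0: "0 < B" using pos leB by (meson ennreal_less_zero_iff less_le_trans)
      from leB obtain d where "0 \<le> d" "sym_KL f_plus f_minus = ennreal d"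
        by (cases "sym_KL f_plus f_minus") (auto simp: top_unique)
      with pos leB B0 show thesis by (intro that[of d]) auto
    qed
    define Q where "Q = real k ^ 2 / (10000 * d)"
    have Q0: "0 \<le> Q" using d by (simp add: Q_def)
    have "ennreal (1 / 10000 * (real k)\<^sup>2) / sym_KL f_plus f_minus = ennreal Q"
      unfolding d(1) using d(2) by (subst divide_ennreal) (auto simp: Q_def)
    with few have EQ: "expected_queries f_plus f_minus R A n P \<le> ennreal Q"
      if "P \<in> clusterings n k" for n P
      using that by (simp add: less_imp_le)
    have KL: "KL f_plus f_minus \<le> ennreal d" "KL f_minus f_plus \<le> ennreal d"
      unfolding d(1)[symmetric] sym_KL_def by auto
    obtain l where l: "l \<in> borel_measurable borel" "\<And>x. 0 \<le> l x" "f_plus = density f_minus l"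
      "integrable f_plus (\<lambda>x. ln (l x))" "(\<integral>x. ln (l x) \<partial>f_plus) \<le> d"
      using KL_le_imp_density[OF dist KL(1)] d(2) by (metis less_imp_le)
    obtain q where q: "q \<in> borel_measurable borel" "\<And>x. 0 \<le> q x" "f_minus = density f_plus q"
      "integrable f_minus (\<lambda>x. ln (q x))" "(\<integral>x. ln (q x) \<partial>f_minus) \<le> d"
      using KL_le_imp_density[OF dist(2,1) KL(2)] d(2) by (metis less_imp_le)
    interpret weighted_pairs f_plus f_minus l
      unfolding weighted_pairs_def using dist[unfolded distribution_on_unit_def] l(1-3) by blast
    show "\<exists>n. \<exists>P\<in>clusterings n k. 1 / 10 \<le> failure_prob f_plus f_minus R A n P"
    \<comment> \<open>If failure were below 1/10 on every input, both bounds would be available with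
      \<open>p = 1 / 10\<close>; the size of \<open>d\<close> decides which one is
      contradicted.\<close>
    proof (rule ccontr)
      assume neg: "\<not> ?thesis"
      then have ok: "failure_prob f_plus f_minus R A n P \<le> 1 / 10" if "P \<in> clusterings n k" for n P
      proof -
        have "\<not> 1 / 10 \<le> failure_prob f_plus f_minus R A n P"
          using neg that by blast
        then show ?thesis by simp
      qed
      show False
      proof (cases "d \<le> 1 / 10")
        case True
        define K where "K = k div 10"
        define M where "M = nat \<lfloor>real k / (10 * d)\<rfloor>"
        have "0 < K" using k by (simp add: K_def)
        then show False
          using random_assignment_bound[OF alg l(4,5) _ _ _ _ ok Q0 EQ, of k K M]
            random_assignment_numeric[OF k(1) d(2) True K_def M_def Q_def] k d(2) by linarith
      next
        case False
        define K where "K = k\<^sup>2 div 160"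
        define s where "s = measure f_minus {x. \<delta> \<le> l x}"
        have "t * measure f_minus {x. l x < \<delta>} \<le> d + 1"
          unfolding \<delta>_def by (rule measure_small_ratio_le[OF q])
        also have "d + 1 \<le> t * (1 / 4)"
          using t d(3) by simp
        finally have "t * measure f_minus {x. l x < \<delta>} \<le> t * (1 / 4)" .
        then have "measure f_minus {x. l x < \<delta>} \<le> 1 / 4"
          using t(1) by (simp only: mult_le_cancel_left_pos)
        moreover have "s = 1 - measure f_minus {x. l x < \<delta>}"
        proof -
          have X: "{x. l x < \<delta>} \<in> sets f_minus"
            unfolding sets_minus by measurable
          have "{x. \<delta> \<le> l x} = space f_minus - {x. l x < \<delta>}"
            using sets_eq_imp_space_eq[OF sets_minus] by auto
          then show ?thesis
            unfolding s_def using minus.prob_compl[OF X] by simp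
        qed
        ultimately have s: "3 / 4 \<le> s" "s \<le> 1" by auto
        have "160 \<le> k\<^sup>2" using power_mono[of 1000 k 2] k(1) by simp
        then have "0 < K" by (simp add: K_def div_greater_zero_iff)
        then show False
          using hidden_pair_bound[OF alg \<delta>(1) _ _ _ _ ok Q0 EQ refl, of K m k, folded s_def]
            hidden_pair_numeric[OF k _ K_def refl Q_def s \<delta> less_imp_le[OF m]] k s False by simp
      qed
    qed
  qed
qed simp

end
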